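(* Let $0 < p \leq q < \infty$ and let $\psi_1, \psi_2, \varphi_1, \varphi_2$ be entire functions on $\mathbb{C}$ with $\psi_1 \not\equiv 0$, $\psi_2 \not\equiv 0$ and $\varphi_1 \not\equiv \varphi_2$. The following statements are true: (a) $W_{\psi_1, \varphi_1} - W_{\psi_2, \varphi_2}: \mathcal{F}^p \to \mathcal{F}^q$ is bounded if and only if both $W_{\psi_1, \varphi_1}: \mathcal{F}^p \to \mathcal{F}^q$ and $W_{\psi_2, \varphi_2}: \mathcal{F}^p \to \mathcal{F}^q$ are bounded. (b) $W_{\psi_1, \varphi_1} - W_{\psi_2, \varphi_2}: \mathcal{F}^p \to \mathcal{F}^q$ is compact if and only if both $W_{\psi_1, \varphi_1}: \mathcal{F}^p \to \mathcal{F}^q$ and $W_{\psi_2, \varphi_2}: \mathcal{F}^p \to \mathcal{F}^q$ are compact.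
   Context: For $p \in (0,\infty)$, the Fock space $\mathcal{F}^p$ is the space of entire functions $f$ on $\mathbb{C}$ with $$\|f\|_p := \left( \frac{p}{2\pi} \int_{\mathbb{C}} |f(z)|^p e^{-\frac{p|z|^2}{2}}\, dA(z) \right)^{1/p} < \infty,$$ where $dA$ is Lebesgue measure on $\mathbb{C}$. For $p \geq 1$ it is a Banach space; for $0<p<1$ it is a complete metric space with distance $d(f,g) = \|f-g\|_p^p$. For entire functions $\psi, \varphi$, the weighted composition operator $W_{\psi,\varphi}$ is defined on entire functions by $W_{\psi,\varphi} f = \psi \cdot (f \circ \varphi)$. An operator is said to be bounded (respectively compact) from $\mathcal{F}^p$ to $\mathcal{F}^q$ if it maps $\mathcal{F}^p$ into $\mathcal{F}^q$ and maps the unit ball $\{f : \|f\|_p \le 1\}$ to a bounded (respectively relatively compact) subset of $\mathcal{F}^q$. *)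

theory Defs
  imports "HOL-Analysis.Analysis"
begin

definition fock_weighted :: "real \<Rightarrow> (complex \<Rightarrow> complex) \<Rightarrow> complex \<Rightarrow> real" where
  "fock_weighted p f = (\<lambda>z. cmod (f z) powr p * exp (- (p * (cmod z)\<^sup>2 / 2)))"

definition fock_norm :: "real \<Rightarrow> (complex \<Rightarrow> complex) \<Rightarrow> real" where
  "fock_norm p f = (p / (2 * pi) * (LINT z|lborel. fock_weighted p f z)) powr (1 / p)"

text \<open>The Bochner integral of a non-integrable function is 0, so finiteness of the norm
  is expressed by integrability of the nonnegative integrand.\<close>

definition fock_space :: "real \<Rightarrow> (complex \<Rightarrow> complex) set" where
  "fock_space p = {f. f holomorphic_on UNIV \<and> integrable lborel (fock_weighted p f)}"

definition fock_dist :: "real \<Rightarrow> (complex \<Rightarrow> complex) \<Rightarrow> (complex \<Rightarrow> complex) \<Rightarrow> real" where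
  "fock_dist p f g =
     (if 1 \<le> p then fock_norm p (\<lambda>z. f z - g z) else fock_norm p (\<lambda>z. f z - g z) powr p)"

definition fock_unit_ball :: "real \<Rightarrow> (complex \<Rightarrow> complex) set" where
  "fock_unit_ball p = {f \<in> fock_space p. fock_norm p f \<le> 1}"

definition weighted_comp ::
    "(complex \<Rightarrow> complex) \<Rightarrow> (complex \<Rightarrow> complex) \<Rightarrow> (complex \<Rightarrow> complex) \<Rightarrow> complex \<Rightarrow> complex" where
  "weighted_comp \<psi> \<phi> f = (\<lambda>z. \<psi> z * (f \<circ> \<phi>) z)"

definition fock_bounded ::
    "real \<Rightarrow> real \<Rightarrow> ((complex \<Rightarrow> complex) \<Rightarrow> complex \<Rightarrow> complex) \<Rightarrow> bool" where
  "fock_bounded p q T \<longleftrightarrow>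
     T ` fock_space p \<subseteq> fock_space q \<and>
     Metric_space.mbounded (fock_space q) (fock_dist q) (T ` fock_unit_ball p)"

definition fock_compact ::
    "real \<Rightarrow> real \<Rightarrow> ((complex \<Rightarrow> complex) \<Rightarrow> complex \<Rightarrow> complex) \<Rightarrow> bool" where
  "fock_compact p q T \<longleftrightarrow>
     T ` fock_space p \<subseteq> fock_space q \<and>
     (let X = Metric_space.mtopology (fock_space q) (fock_dist q)
      in compactin X (X closure_of (T ` fock_unit_ball p)))"

text \<open>The notions of \<^locale>\<open>Metric_space\<close> used above are meaningful because
  \<^const>\<open>fock_dist\<close> is a metric on \<^const>\<open>fock_space\<close>, which is shown in the rest of
  this theory.\<close>

lemma fock_weighted_nonneg: "0 \<le> fock_weighted p f z"
  by (simp add: fock_weighted_def)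

lemma fock_weighted_measurable [measurable]:
  assumes "f holomorphic_on UNIV"
  shows "fock_weighted p f \<in> borel_measurable lborel"
proof -
  have [measurable]: "f \<in> borel_measurable borel"
    using assms by (intro borel_measurable_continuous_onI holomorphic_on_imp_continuous_on)
  show ?thesis unfolding fock_weighted_def by measurable
qed

lemma powr_add_le_2:
  fixes a b :: real
  assumes "0 < p" "0 \<le> a" "0 \<le> b"
  shows "(a + b) powr p \<le> 2 powr p * (a powr p + b powr p)"
proof -
  have "(a + b) powr p \<le> (2 * max a b) powr p"
    using assms by (intro powr_mono2) auto
  also have "\<dots> = 2 powr p * (max a b powr p)" using assms by (simp add: powr_mult)
  also have "\<dots> \<le> 2 powr p * (a powr p + b powr p)" by (auto simp: max_def)
  finally show ?thesis .
qed

lemma powr_add_le_small: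
  fixes a b :: real
  assumes "0 < p" "p \<le> 1" "0 \<le> a" "0 \<le> b"
  shows "(a + b) powr p \<le> a powr p + b powr p"
proof (cases "a + b = 0")
  case False
  define s where "s = a + b"
  have s: "0 < s" using False assms by (simp add: s_def)
  have *: "x / s \<le> (x / s) powr p" if "0 \<le> x" "x \<le> s" for x
    using powr_mono'[of p 1 "x / s"] that s assms by simp
  have "1 = a / s + b / s" using s by (simp add: s_def flip: add_divide_distrib)
  also have "\<dots> \<le> (a / s) powr p + (b / s) powr p"
    using assms by (intro add_mono *) (auto simp: s_def)
  also have "\<dots> = (a powr p + b powr p) / s powr p"
    using assms s by (simp add: powr_divide add_divide_distrib)
  finally show ?thesis using s by (simp add: s_def field_simps)
qed (use assms in auto)

lemma powr_convex_nonneg: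
  fixes x y u :: real
  assumes p: "1 \<le> p" and "0 \<le> x" "0 \<le> y" "0 \<le> u" "u \<le> 1"
  shows "((1 - u) * x + u * y) powr p \<le> (1 - u) * x powr p + u * y powr p"
proof -
  have *: "(v * w) powr p \<le> v * w powr p" if "0 \<le> v" "v \<le> 1" "0 \<le> w" for v w :: real
  proof -
    have "v powr p \<le> v"
      using powr_mono'[of 1 p v] that p by simp
    then show ?thesis
      using that by (simp add: powr_mult mult_right_mono)
  qed
  consider "x = 0" | "y = 0" | "0 < x" "0 < y" using assms by linarith
  then show ?thesis
  proof cases
    case 1
    then show ?thesis using *[of u y] assms by simp
  next
    case 2
    then show ?thesis using *[of "1 - u" x] assms by simp
  next
    case 3
    then show ?thesis using convex_onD[OF powr_convex[OF p], of u x y] assms by simp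
  qed
qed

lemma powr_add_le_convex:
  fixes a b s t :: real
  assumes "1 \<le> p" "0 \<le> a" "0 \<le> b" "0 < s" "0 < t"
  shows "(a + b) powr p \<le> (s + t) powr (p - 1) * (s powr (1 - p) * a powr p + t powr (1 - p) * b powr p)"
proof -
  define u where "u = t / (s + t)"
  have u: "0 \<le> u" "u \<le> 1" "1 - u = s / (s + t)"
    using assms by (auto simp: u_def field_simps)
  have "((1 - u) * (a / s) + u * (b / t)) powr p
          \<le> (1 - u) * (a / s) powr p + u * (b / t) powr p"
    using assms u by (intro powr_convex_nonneg) auto
  also have "(1 - u) * (a / s) + u * (b / t) = (a + b) / (s + t)"
    unfolding u(3) using assms by (simp add: u_def add_divide_distrib)
  finally have "(a + b) powr p / (s + t) powr p
      \<le> s / (s + t) * (a powr p / s powr p) + t / (s + t) * (b powr p / t powr p)"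
    using assms u(3) by (simp add: powr_divide u_def)
  then have "(a + b) powr p
      \<le> (s + t) powr p * (s / (s + t) * (a powr p / s powr p) + t / (s + t) * (b powr p / t powr p))"
    using assms by (simp add: divide_le_eq mult.commute)
  also have "\<dots> = (s + t) powr (p - 1) * (s powr (1 - p) * a powr p + t powr (1 - p) * b powr p)"
  proof -
    have eq: "S * (s / (s + t) * (A / s') + t / (s + t) * (B / t'))
        = S / (s + t) * (s / s' * A + t / t' * B)" for S A B s' t' :: real
      by (simp add: distrib_left)
    show ?thesis using assms by (simp add: eq powr_diff del: times_divide_eq_left times_divide_eq_right)
  qed
  finally show ?thesis .
qed

lemma fock_space_diff:
  assumes p: "0 < p" and f: "f \<in> fock_space p" and g: "g \<in> fock_space p"
  shows "(\<lambda>z. f z - g z) \<in> fock_space p"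
proof -
  have holo: "(\<lambda>z. f z - g z) holomorphic_on UNIV"
    using f g by (auto simp: fock_space_def intro: holomorphic_on_diff)
  have "integrable lborel (\<lambda>z. 2 powr p * (fock_weighted p f z + fock_weighted p g z))"
    using f g by (auto simp: fock_space_def)
  then have "integrable lborel (fock_weighted p (\<lambda>z. f z - g z))"
  proof (rule Bochner_Integration.integrable_bound)
    show "fock_weighted p (\<lambda>z. f z - g z) \<in> borel_measurable lborel"
      using holo by (rule fock_weighted_measurable)
    have "fock_weighted p (\<lambda>z. f z - g z) z \<le> 2 powr p * (fock_weighted p f z + fock_weighted p g z)" for z
    proof -
      have "cmod (f z - g z) powr p \<le> (cmod (f z) + cmod (g z)) powr p"
        using p by (intro powr_mono2 norm_triangle_ineq4) auto
      also have "\<dots> \<le> 2 powr p * (cmod (f z) powr p + cmod (g z) powr p)"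
        using p by (intro powr_add_le_2) auto
      finally have "cmod (f z - g z) powr p * exp (- (p * (cmod z)\<^sup>2 / 2))
        \<le> 2 powr p * (cmod (f z) powr p + cmod (g z) powr p) * exp (- (p * (cmod z)\<^sup>2 / 2))"
        by (intro mult_right_mono) auto
      then show ?thesis by (simp add: fock_weighted_def algebra_simps)
    qed
    then show "AE z in lborel. norm (fock_weighted p (\<lambda>z. f z - g z) z)
        \<le> norm (2 powr p * (fock_weighted p f z + fock_weighted p g z))"
      by (intro AE_I2) (simp add: fock_weighted_nonneg add_nonneg_nonneg)
  qed
  with holo show ?thesis by (simp add: fock_space_def)
qed

lemma fock_integral_nonneg: "0 \<le> p \<Longrightarrow> 0 \<le> p / (2 * pi) * (LINT z|lborel. fock_weighted p f z)"
  by (intro mult_nonneg_nonneg integral_nonneg_AE) (auto simp: fock_weighted_nonneg)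

lemma fock_norm_powr:
  assumes "0 < p"
  shows "fock_norm p f powr p = p / (2 * pi) * (LINT z|lborel. fock_weighted p f z)"
proof -
  have "1 / p * p = 1" using assms by simp
  then show ?thesis
    using fock_integral_nonneg[of p f] assms by (simp only: fock_norm_def powr_powr powr_one less_imp_le)
qed

lemma fock_norm_eq_0_iff:
  assumes p: "0 < p" and f: "f \<in> fock_space p"
  shows "fock_norm p f = 0 \<longleftrightarrow> f = (\<lambda>_. 0)"
proof
  assume "fock_norm p f = 0"
  then have "(LINT z|lborel. fock_weighted p f z) = 0"
    using p by (simp add: fock_norm_def)
  then have "AE z in lborel. fock_weighted p f z = 0"
    using f by (subst (asm) integral_nonneg_eq_0_iff_AE) (auto simp: fock_space_def fock_weighted_nonneg)
  then have AE: "AE z in lborel. f z = 0"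
    by (simp add: fock_weighted_def)
  have cont: "continuous_on UNIV f"
    using f by (auto simp: fock_space_def intro: holomorphic_on_imp_continuous_on)
  define S where "S = f -` (- {0})"
  have "open S"
    unfolding S_def using cont by (intro open_vimage) auto
  moreover have "S \<in> null_sets lborel"
    using AE \<open>open S\<close> by (subst AE_iff_null_sets) (auto simp: S_def)
  then have "negligible S"
    using null_sets_completionI by (auto simp: negligible_iff_null_sets)
  ultimately have "S = {}"
    using open_not_negligible by blast
  then show "f = (\<lambda>_. 0)" by (auto simp: S_def fun_eq_iff)
next
  assume "f = (\<lambda>_. 0)"
  then show "fock_norm p f = 0" using p by (simp add: fock_norm_def fock_weighted_def)
qed

lemma fock_norm_triangle:
  assumes p: "1 \<le> p" and f: "f \<in> fock_space p" and g: "g \<in> fock_space p"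
    and h: "h \<in> fock_space p" and le: "\<And>z. cmod (h z) \<le> cmod (f z) + cmod (g z)"
  shows "fock_norm p h \<le> fock_norm p f + fock_norm p g"
proof -
  define c where "c = p / (2 * pi)"
  have c: "0 < c" using p by (simp add: c_def)
  have int: "integrable lborel (fock_weighted p f)" "integrable lborel (fock_weighted p g)"
      "integrable lborel (fock_weighted p h)"
    using f g h by (auto simp: fock_space_def)
  have nonneg: "0 \<le> fock_norm p k" for k by (simp add: fock_norm_def)
  have main: "fock_norm p h \<le> s + t" if s: "fock_norm p f < s" and t: "fock_norm p g < t" for s t
  proof -
    have s0: "0 < s" and t0: "0 < t" using s t nonneg[of f] nonneg[of g] by auto
    have pt: "fock_weighted p h z \<le> (s + t) powr (p - 1) *
        (s powr (1 - p) * fock_weighted p f z + t powr (1 - p) * fock_weighted p g z)" for z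
    proof -
      have "cmod (h z) powr p \<le> (cmod (f z) + cmod (g z)) powr p"
        using p le by (intro powr_mono2) auto
      also have "\<dots> \<le> (s + t) powr (p - 1) *
          (s powr (1 - p) * cmod (f z) powr p + t powr (1 - p) * cmod (g z) powr p)"
        using p s0 t0 by (intro powr_add_le_convex) auto
      finally have "cmod (h z) powr p * exp (- (p * (cmod z)\<^sup>2 / 2)) \<le> (s + t) powr (p - 1) *
          (s powr (1 - p) * cmod (f z) powr p + t powr (1 - p) * cmod (g z) powr p)
          * exp (- (p * (cmod z)\<^sup>2 / 2))"
        by (intro mult_right_mono) auto
      then show ?thesis by (simp add: fock_weighted_def algebra_simps)
    qed
    have "(LINT z|lborel. fock_weighted p h z) \<le> (LINT z|lborel. (s + t) powr (p - 1) *
        (s powr (1 - p) * fock_weighted p f z + t powr (1 - p) * fock_weighted p g z))"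
      using int pt by (intro integral_mono) auto
    also have "\<dots> = (s + t) powr (p - 1) * (s powr (1 - p) * (LINT z|lborel. fock_weighted p f z)
        + t powr (1 - p) * (LINT z|lborel. fock_weighted p g z))"
      using int by simp
    finally have "c * (LINT z|lborel. fock_weighted p h z) \<le>
        c * ((s + t) powr (p - 1) * (s powr (1 - p) * (LINT z|lborel. fock_weighted p f z)
        + t powr (1 - p) * (LINT z|lborel. fock_weighted p g z)))"
      using c by (intro mult_left_mono) auto
    also have "\<dots> = (s + t) powr (p - 1) * (s powr (1 - p) * (c * (LINT z|lborel. fock_weighted p f z))
        + t powr (1 - p) * (c * (LINT z|lborel. fock_weighted p g z)))"
      by (simp add: algebra_simps)
    finally have "fock_norm p h powr p \<le> (s + t) powr (p - 1) *
        (s powr (1 - p) * (fock_norm p f powr p) + t powr (1 - p) * (fock_norm p g powr p))"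
      using p by (simp add: fock_norm_powr c_def)
    also have "\<dots> \<le> (s + t) powr (p - 1) * (s powr (1 - p) * s powr p + t powr (1 - p) * t powr p)"
      using p s t nonneg by (intro mult_left_mono add_mono powr_mono2) auto
    also have "\<dots> = (s + t) powr p"
      using s0 t0 by (simp add: powr_diff flip: powr_add)
    finally show ?thesis
      using powr_less_mono2[of p "s + t" "fock_norm p h"] p s0 t0 by fastforce
  qed
  show ?thesis
  proof (rule field_le_epsilon)
    fix e :: real assume "0 < e"
    then show "fock_norm p h \<le> fock_norm p f + fock_norm p g + e"
      using main[of "fock_norm p f + e / 2" "fock_norm p g + e / 2"] by simp
  qed
qed

lemma fock_norm_powr_triangle:
  assumes p: "0 < p" "p \<le> 1" and f: "f \<in> fock_space p" and g: "g \<in> fock_space p"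
    and h: "h \<in> fock_space p" and le: "\<And>z. cmod (h z) \<le> cmod (f z) + cmod (g z)"
  shows "fock_norm p h powr p \<le> fock_norm p f powr p + fock_norm p g powr p"
proof -
  have int: "integrable lborel (fock_weighted p f)" "integrable lborel (fock_weighted p g)"
      "integrable lborel (fock_weighted p h)"
    using f g h by (auto simp: fock_space_def)
  have pt: "fock_weighted p h z \<le> fock_weighted p f z + fock_weighted p g z" for z
  proof -
    have "cmod (h z) powr p \<le> (cmod (f z) + cmod (g z)) powr p"
      using p le by (intro powr_mono2) auto
    also have "\<dots> \<le> cmod (f z) powr p + cmod (g z) powr p"
      using p by (intro powr_add_le_small) auto
    finally have "cmod (h z) powr p * exp (- (p * (cmod z)\<^sup>2 / 2))
        \<le> (cmod (f z) powr p + cmod (g z) powr p) * exp (- (p * (cmod z)\<^sup>2 / 2))"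
      by (intro mult_right_mono) auto
    then show ?thesis by (simp add: fock_weighted_def algebra_simps)
  qed
  have "(LINT z|lborel. fock_weighted p h z)
      \<le> (LINT z|lborel. fock_weighted p f z + fock_weighted p g z)"
    using int pt by (intro integral_mono) auto
  also have "\<dots> = (LINT z|lborel. fock_weighted p f z) + (LINT z|lborel. fock_weighted p g z)"
    using int by simp
  finally have "p / (2 * pi) * (LINT z|lborel. fock_weighted p h z)
      \<le> p / (2 * pi) * ((LINT z|lborel. fock_weighted p f z) + (LINT z|lborel. fock_weighted p g z))"
    using p by (intro mult_left_mono) auto
  then show ?thesis using p by (simp only: fock_norm_powr distrib_left)
qed

lemma Metric_space_fock:
  assumes p: "0 < p"
  shows "Metric_space (fock_space p) (fock_dist p)"
proof
  fix f g h
  show "0 \<le> fock_dist p f g" by (simp add: fock_dist_def fock_norm_def)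
  show "fock_dist p f g = fock_dist p g f"
    by (simp add: fock_dist_def fock_norm_def fock_weighted_def norm_minus_commute)
  assume f: "f \<in> fock_space p" and g: "g \<in> fock_space p"
  show "fock_dist p f g = 0 \<longleftrightarrow> f = g"
    using fock_norm_eq_0_iff[OF p fock_space_diff[OF p f g]]
    by (auto simp: fock_dist_def fun_eq_iff)
  assume h: "h \<in> fock_space p"
  have le: "cmod (f z - h z) \<le> cmod (f z - g z) + cmod (g z - h z)" for z
    using norm_triangle_ineq[of "f z - g z" "g z - h z"] by simp
  note mem = fock_space_diff[OF p f g] fock_space_diff[OF p g h] fock_space_diff[OF p f h]
  show "fock_dist p f h \<le> fock_dist p f g + fock_dist p g h"
    using fock_norm_triangle[OF _ mem le] fock_norm_powr_triangle[OF p _ mem le]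
    by (auto simp: fock_dist_def)
qed

end

theory Submission
  imports Defs "HOL-Complex_Analysis.Complex_Analysis" "HOL-Probability.Distributions"
    "HOL-Real_Asymp.Real_Asymp"
begin

text \<open>Write \<open>m\<^sub>i(z) = |\<psi>\<^sub>i(z)| exp((|\<phi>\<^sub>i(z)|\<^sup>2 - |z|\<^sup>2)/2)\<close> and \<open>d = |\<phi>\<^sub>1 - \<phi>\<^sub>2|\<close>.  Let \<open>k\<^sub>w\<close> be the normalised
  kernels, \<open>T\<close> the difference of the operators, and \<open>E\<close> a bound for \<open>|T k\<^sub>w(z)| exp(-|z|\<^sup>2/2)\<close>.  Taking
  \<open>w = \<phi>\<^sub>1(z)\<close> gives \<open>m\<^sub>1 \<le> E + exp(-d\<^sup>2/2) m\<^sub>2\<close>, and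
  symmetrically with the indices exchanged; hence \<open>m\<^sub>i d\<^sup>2 \<le> 2E (1 + d\<^sup>2)\<close>.  Thus the entire function
  \<open>g = \<psi>\<^sub>1 \<psi>\<^sub>2 (\<phi>\<^sub>1 - \<phi>\<^sub>2)\<^sup>4\<close>, which is not identically \<open>0\<close>, satisfies
  \<open>|g(z)| exp(|\<phi>\<^sub>i(z)|\<^sup>2/4) \<le> C exp(|z|\<^sup>2)\<close>, and this growth forces both \<open>\<phi>\<^sub>i\<close> to be affine.  Then \<open>d\<close> is
  bounded away from \<open>0\<close> outside a disc, so both \<open>m\<^sub>i\<close> are bounded, which makes
  the \<open>i\<close>-th operator bounded whenever \<open>\<phi>\<^sub>i\<close> is not constant; constant symbols are handled by a test function or
  by subtraction.  For compactness the kernels tend to \<open>0\<close> pointwise, so \<open>E\<close> can be taken to tend to \<open>0\<close>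
  at infinity, whence \<open>m\<^sub>i \<rightarrow> 0\<close>; conversely this implies compactness by Montel's theorem.\<close>

section \<open>Growth of entire functions\<close>

text \<open>The separation estimate says nothing where the two symbols agree, and such points cannot
  be located before the symbols are known to be affine. Hence \<open>d\<^sup>2\<close> stays as a
  factor instead of being divided out, and the growth statement carries an entire multiplier that
  may vanish. The factor \<open>1 + d\<^sup>2\<close> on the right involves both symbols and is not
  absorbed by the exponential of one of them. In the product of the two estimates, half of the
  exponent \<open>(|\<phi>1|\<^sup>2 + |\<phi>2|\<^sup>2) / 2\<close> absorbs both such factors; the
  other half yields the quarter in the growth bound. Constant symbols are exceptional because a
  bounded weight does not place \<open>\<psi>\<close> in the target space, and kernels centred at
  the constant do not tend to 0. Such an operator has rank at most one, so it is compact as soon as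
  \<open>\<psi>\<close> lies in the target space. Exponents below 1 need no separate treatment:
  norms are replaced by the unnormalised integrals of the weighted power, for which a difference
  costs only the factor \<open>2 powr q\<close>.\<close>

lemma entire_factor_zero:
  fixes f :: "complex \<Rightarrow> complex"
  assumes f: "f holomorphic_on UNIV" and nz: "f \<noteq> (\<lambda>z. 0)"
  obtains n g where "g holomorphic_on UNIV" "g 0 \<noteq> 0" "\<And>z. f z = z ^ n * g z"
proof -
  have ex: "\<exists>w\<in>UNIV. f w \<noteq> 0" using nz by auto
  define n where "n = nat (zorder f 0)"
  define g where "g = zor_poly f 0"
  obtain r where r: "0 < r" "g holomorphic_on cball 0 r"
      "\<And>w. w \<in> cball 0 r \<Longrightarrow> f w = g w * w ^ n \<and> g w \<noteq> 0"
    using zorder_exist_zero[OF f open_UNIV connected_UNIV UNIV_I[of 0] ex] that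
    unfolding n_def g_def diff_0_right by metis
  \<comment> \<open>The local cofactor agrees with the quotient on the punctured disc, so gluing the
    two gives an entire function.\<close>
  define G where "G z = (if z \<in> ball 0 r then g z else f z / z ^ n)" for z
  have "G holomorphic_on (ball 0 r \<union> (- {0}))"
  proof (rule holomorphic_on_Un)
    show "G holomorphic_on ball 0 r"
      by (rule holomorphic_transform[of g]) (auto simp: G_def intro: holomorphic_on_subset[OF r(2)])
    have "(\<lambda>z. f z / z ^ n) holomorphic_on - {0}"
      by (intro holomorphic_intros holomorphic_on_subset[OF f]) auto
    moreover have "f z / z ^ n = G z" if "z \<in> - {0}" for z
      using that r(3)[of z] by (auto simp: G_def)
    ultimately show "G holomorphic_on - {0}"
      by (rule holomorphic_transform)
  qed auto
  moreover have "ball 0 r \<union> (- {0}) = (UNIV :: complex set)" using r(1) by auto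
  ultimately have "G holomorphic_on UNIV" by simp
  moreover have "G 0 \<noteq> 0" using r(3)[of 0] r(1) by (simp add: G_def)
  moreover have "f z = z ^ n * G z" for z
    using r(3)[of z] r(1) by (cases "z = 0") (auto simp: G_def)
  ultimately show thesis by (rule that)
qed

lemma entire_factor_linear:
  fixes f :: "complex \<Rightarrow> complex"
  assumes f: "f holomorphic_on UNIV"
  obtains g where "g holomorphic_on UNIV" "\<And>z. f z = f 0 + z * g z"
proof -
  have "(\<lambda>z. if z = 0 then deriv f 0 else (f z - f 0) / (z - 0)) holomorphic_on UNIV"
    using f by (intro pole_lemma) auto
  then show thesis by (rule that) auto
qed

text \<open>Suppose \<open>\<phi> z = p\<^sub>0 + p\<^sub>1 z + z\<^sup>n Q z\<close> with \<open>n \<ge> 2\<close> and \<open>Q 0 \<noteq> 0\<close>.  On the circle \<open>|z| = r\<close> the function \<open>Re (c z\<^sup>-\<^sup>n \<phi> z)\<close> agrees with the real part of an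
  entire function whose value at \<open>0\<close> is \<open>c Q(0)\<close>, since conjugation there turns
  \<open>z\<^sup>k\<^sup>-\<^sup>n\<close> into \<open>(z / r\<^sup>2)\<^sup>n\<^sup>-\<^sup>k\<close>.  The maximum principle then plays the part of Jensen's formula.\<close>

lemma growth_imp_affine:
  fixes g \<phi> :: "complex \<Rightarrow> complex"
  assumes g: "g holomorphic_on UNIV" and nz: "g \<noteq> (\<lambda>z. 0)"
    and phi: "\<phi> holomorphic_on UNIV"
    and growth: "\<And>z. cmod (g z) * exp ((cmod (\<phi> z))\<^sup>2 / 4) \<le> C * exp ((cmod z)\<^sup>2)"
  obtains a b where "\<And>z. \<phi> z = a * z + b"
proof -
  obtain \<phi>' where 1: "\<phi>' holomorphic_on UNIV" "\<And>z. \<phi> z = \<phi> 0 + z * \<phi>' z"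
    using entire_factor_linear[OF phi] by metis
  obtain \<phi>'' where 2: "\<phi>'' holomorphic_on UNIV" "\<And>z. \<phi>' z = \<phi>' 0 + z * \<phi>'' z"
    using entire_factor_linear[OF 1(1)] by metis
  define p0 p1 where "p0 = \<phi> 0" and "p1 = \<phi>' 0"
  have exp2: "\<phi> z = p0 + p1 * z + z ^ 2 * \<phi>'' z" for z
    using 1(2)[of z] 2(2)[of z] by (simp add: p0_def p1_def algebra_simps power2_eq_square)
  have "\<phi>'' = (\<lambda>z. 0)"
  proof (rule ccontr)
    assume "\<phi>'' \<noteq> (\<lambda>z. 0)"
    then obtain j Q where Q: "Q holomorphic_on UNIV" "Q 0 \<noteq> 0" "\<And>z. \<phi>'' z = z ^ j * Q z"
      using entire_factor_zero[OF 2(1)] by metis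
    obtain k h where h: "h holomorphic_on UNIV" "h 0 \<noteq> 0" "\<And>z. g z = z ^ k * h z"
      using entire_factor_zero[OF g nz] by metis
    \<comment> \<open>The degree of the first nonzero Taylor term of \<open>\<phi>\<close> beyond
      the linear ones. That it is at least 2 makes \<open>r ^ (2 * n)\<close> outgrow
      \<open>r\<^sup>2\<close> in the end.\<close>
    define n where "n = Suc (Suc j)"
    have phi_n: "\<phi> z = p0 + p1 * z + z ^ n * Q z" for z
      using exp2[of z] Q(3)[of z] by (simp add: n_def algebra_simps power2_eq_square)
    have bound: "(cmod (Q 0))\<^sup>2 * r ^ (2 * n) / 4 \<le> ln (C / cmod (h 0)) + r\<^sup>2 \<and> 0 < C" if r: "1 \<le> r" for r :: real
    proof -
      \<comment> \<open>With \<open>c = t * cnj (Q 0)\<close> the exponent gained at 0 is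
        \<open>t - t\<^sup>2 / r ^ (2 * n)\<close> times \<open>|Q 0|\<^sup>2\<close>; this
        \<open>t\<close> maximises it.\<close>
      define t where "t = r ^ (2 * n) / 2"
      define c where "c = complex_of_real t * cnj (Q 0)"
      \<comment> \<open>The reflection of the principal part of \<open>c * \<phi> z / z ^ n\<close>.
        Both exponents are positive because \<open>n \<ge> 2\<close>, so \<open>S 0 = 0\<close> and
        the value of \<open>H\<close> at 0 is unaffected.\<close>
      define S where "S z = cnj c * (cnj p0 * (z / of_real (r\<^sup>2)) ^ n + cnj p1 * (z / of_real (r\<^sup>2)) ^ (n - 1))" for z
      define H where "H z = h z * exp (c * Q z + S z)" for z
      have "H holomorphic_on UNIV" unfolding H_def S_def
        using h(1) Q(1) r by (intro holomorphic_intros) auto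
      have circle: "cmod (H z) \<le> C * exp (r\<^sup>2 + (cmod c)\<^sup>2 / r ^ (2 * n))" if z: "cmod z = r" for z
      proof -
        have z0: "z \<noteq> 0" using z r by auto
        have zc: "cnj (z / of_real (r\<^sup>2)) = inverse z"
          using z z0 complex_norm_square[of z] by (simp add: field_simps)
        have "cnj (S z) = c * (p0 * inverse z ^ n + p1 * inverse z ^ (n - 1))"
          unfolding S_def complex_cnj_mult complex_cnj_add complex_cnj_power zc by simp
        also have "\<dots> = c * (p0 + p1 * z) / z ^ n"
          using z0 by (simp add: n_def field_simps)
        finally have "Re (S z) = Re (c * (p0 + p1 * z) / z ^ n)"
          by (metis cnj.simps(1))
        moreover have "c * \<phi> z / z ^ n = c * (p0 + p1 * z) / z ^ n + c * Q z"
          using z0 by (simp add: phi_n field_simps)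
        ultimately have Re_eq: "Re (c * Q z + S z) = Re (c * \<phi> z / z ^ n)" by simp
        have "Re (c * \<phi> z / z ^ n) \<le> cmod (c * \<phi> z / z ^ n)" by (rule complex_Re_le_cmod)
        also have "\<dots> = cmod c / r ^ n * cmod (\<phi> z)" using z by (simp add: norm_mult norm_divide norm_power)
        \<comment> \<open>Young's inequality, weighted so that \<open>|\<phi> z|\<^sup>2\<close>
          receives exactly the coefficient 1/4 of the growth hypothesis.\<close>
        also have "\<dots> \<le> (cmod (\<phi> z))\<^sup>2 / 4 + (cmod c / r ^ n)\<^sup>2"
          using zero_le_power2[of "cmod (\<phi> z) / 2 - cmod c / r ^ n"]
          by (simp add: power2_diff power_divide mult.commute)
        also have "(cmod c / r ^ n)\<^sup>2 = (cmod c)\<^sup>2 / r ^ (2 * n)"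
          by (simp add: power_divide power_mult mult.commute flip: power_mult)
        finally have Re_le: "Re (c * Q z + S z) \<le> (cmod (\<phi> z))\<^sup>2 / 4 + (cmod c)\<^sup>2 / r ^ (2 * n)"
          using Re_eq by simp
        \<comment> \<open>Here \<open>r \<ge> 1\<close> is used: dividing \<open>g\<close> by
          \<open>z ^ k\<close> does not increase it on the circle.\<close>
        have "cmod (h z) \<le> cmod (g z)"
          using h(3)[of z] z r one_le_power[of r k] mult_right_mono[of 1 "r ^ k" "cmod (h z)"]
          by (simp add: norm_mult norm_power)
        then have "cmod (H z) \<le> cmod (g z) * exp ((cmod (\<phi> z))\<^sup>2 / 4 + (cmod c)\<^sup>2 / r ^ (2 * n))"
          unfolding H_def norm_mult norm_exp_eq_Re using Re_le by (intro mult_mono) auto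
        also have "\<dots> = cmod (g z) * exp ((cmod (\<phi> z))\<^sup>2 / 4) * exp ((cmod c)\<^sup>2 / r ^ (2 * n))"
          by (simp add: exp_add)
        also have "\<dots> \<le> C * exp ((cmod z)\<^sup>2) * exp ((cmod c)\<^sup>2 / r ^ (2 * n))"
          by (intro mult_right_mono growth) auto
        finally show ?thesis using z by (simp add: exp_add)
      qed
      have "cmod (H 0) \<le> C * exp (r\<^sup>2 + (cmod c)\<^sup>2 / r ^ (2 * n))"
        by (rule maximum_modulus_frontier[of H "cball 0 r"])
           (use r \<open>H holomorphic_on UNIV\<close> circle in \<open>auto intro: holomorphic_on_subset holomorphic_on_imp_continuous_on\<close>)
      moreover have "S 0 = 0" by (simp add: S_def n_def)
      moreover have "c * Q 0 = of_real (t * (cmod (Q 0))\<^sup>2)"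
        using complex_norm_square[of "Q 0"] by (simp add: c_def mult_ac)
      moreover have "(cmod c)\<^sup>2 / r ^ (2 * n) = t * (cmod (Q 0))\<^sup>2 / 2"
      proof -
        have "cmod c = t * cmod (Q 0)" using r by (simp add: c_def norm_mult t_def del: of_real_divide)
        then have "(cmod c)\<^sup>2 / (2 * t) = t * (cmod (Q 0))\<^sup>2 / 2"
          by (simp add: power2_eq_square)
        moreover have "r ^ (2 * n) = 2 * t" by (simp add: t_def)
        ultimately show ?thesis by metis
      qed
      ultimately have le: "cmod (h 0) * exp (t * (cmod (Q 0))\<^sup>2) \<le> C * exp (r\<^sup>2 + t * (cmod (Q 0))\<^sup>2 / 2)"
        by (simp add: H_def norm_mult del: of_real_mult)
      have "0 < cmod (h 0) * exp (t * (cmod (Q 0))\<^sup>2)" using h(2) by simp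
      with le have C: "0 < C"
        by (smt (verit) exp_gt_zero mult_nonpos_nonneg)
      \<comment> \<open>The right side carries half of the exponent on the left, so one factor
        \<open>E\<close> cancels and one survives.\<close>
      define E where "E = exp (t * (cmod (Q 0))\<^sup>2 / 2)"
      have "exp (t * (cmod (Q 0))\<^sup>2) = E * E" by (simp add: E_def flip: exp_add)
      with le have "(cmod (h 0) * E) * E \<le> (C * exp (r\<^sup>2)) * E"
        by (simp add: E_def exp_add mult.assoc)
      then have "cmod (h 0) * E \<le> C * exp (r\<^sup>2)"
        by (rule mult_right_le_imp_le) (simp add: E_def)
      then have "E \<le> C / cmod (h 0) * exp (r\<^sup>2)"
        using h(2) by (simp add: field_simps)
      also have "\<dots> = exp (ln (C / cmod (h 0)) + r\<^sup>2)"
        using C h(2) by (simp add: exp_add)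
      finally show ?thesis using C by (simp add: E_def t_def mult_ac)
    qed
    have lim: "LIM r at_top. (cmod (Q 0))\<^sup>2 * r ^ 4 / 4 - r\<^sup>2 :> at_top"
    proof -
      have "0 < (cmod (Q 0))\<^sup>2" using Q(2) by simp
      then show ?thesis by real_asymp
    qed
    then have "\<forall>\<^sub>F r in at_top. ln (C / cmod (h 0)) < (cmod (Q 0))\<^sup>2 * r ^ 4 / 4 - r\<^sup>2"
      by (simp add: filterlim_at_top_dense)
    then obtain r where r: "1 \<le> r" "ln (C / cmod (h 0)) < (cmod (Q 0))\<^sup>2 * r ^ 4 / 4 - r\<^sup>2"
      using eventually_conj[OF eventually_ge_at_top[of 1]] eventually_happens
      by (metis (mono_tags, lifting) trivial_limit_at_top_linorder)
    have "r ^ 4 \<le> r ^ (2 * n)" using r(1) by (intro power_increasing) (auto simp: n_def)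
    then have "(cmod (Q 0))\<^sup>2 * r ^ 4 \<le> (cmod (Q 0))\<^sup>2 * r ^ (2 * n)" by (intro mult_left_mono) auto
    with bound[OF r(1)] r(2) show False by simp
  qed
  then have "\<phi> z = p1 * z + p0" for z using exp2[of z] by simp
  then show thesis by (rule that)
qed

section \<open>Point evaluations and embeddings of Fock spaces\<close>

text \<open>Cauchy's estimate bounds the derivative by \<open>2 * K * |h a| / s\<close> on the disc
  of half the radius, so over a distance \<open>s / (4 * K)\<close> the value changes by at most
  half of \<open>|h a|\<close>.\<close>

lemma holomorphic_lower_bound_near:
  fixes h :: "complex \<Rightarrow> complex"
  assumes h: "h holomorphic_on UNIV" and s: "0 < s" and K: "1 \<le> K" and A: "0 < cmod (h a)"
    and le: "\<And>x. x \<in> cball a s \<Longrightarrow> cmod (h x) \<le> K * cmod (h a)"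
    and x: "x \<in> ball a (s / (4 * K))"
  shows "cmod (h a) / 2 \<le> cmod (h x)"
proof -
  have deriv_le: "cmod (deriv h y) \<le> K * cmod (h a) / (s / 2)" if y: "y \<in> cball a (s / 2)" for y
  proof -
    have "cmod ((deriv ^^ 1) h y) \<le> fact 1 * (K * cmod (h a)) / (s / 2) ^ 1"
    proof (rule Cauchy_inequality)
      fix u assume "cmod (y - u) = s / 2"
      then show "cmod (h u) \<le> K * cmod (h a)"
        using y dist_triangle[of a u y] by (intro le) (simp add: dist_norm)
    next
      show "h holomorphic_on ball y (s / 2)" using h by (rule holomorphic_on_subset) simp
      show "continuous_on (cball y (s / 2)) h"
        using holomorphic_on_imp_continuous_on[OF h] by (rule continuous_on_subset) simp
    qed (use s in simp)
    then show ?thesis by simp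
  qed
  have sK: "s / (4 * K) \<le> s / 2" using s K by (intro divide_left_mono) auto
  have "cmod (h x - h a) \<le> K * cmod (h a) / (s / 2) * cmod (x - a)"
  proof (rule field_differentiable_bound[of "cball a (s / 2)" h "deriv h"])
    fix z assume "z \<in> cball a (s / 2)"
    show "(h has_field_derivative deriv h z) (at z within cball a (s / 2))"
      using holomorphic_derivI[OF h open_UNIV UNIV_I] by (rule has_field_derivative_at_within)
    show "cmod (deriv h z) \<le> K * cmod (h a) / (s / 2)" if "z \<in> cball a (s / 2)"
      using that by (rule deriv_le)
  next
    show "x \<in> cball a (s / 2)" "a \<in> cball a (s / 2)" using x sK s by auto
  qed simp
  also have "\<dots> \<le> K * cmod (h a) / (s / 2) * (s / (4 * K))"
    using x s K A by (intro mult_left_mono) (auto simp: dist_norm norm_minus_commute)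
  also have "\<dots> = cmod (h a) / 2" using s K by simp
  finally show ?thesis using norm_triangle_ineq2[of "h a" "h x"] by (simp add: norm_minus_commute)
qed

text \<open>Maximising \<open>|h x| (1 - |x|)\<^bsup>2/p\<^esup>\<close> over the disc produces a point \<open>a\<close> near which \<open>|h|\<close> is at
  most a constant times \<open>|h a|\<close>; Cauchy's estimate then bounds \<open>|h|\<close> from below on a disc around \<open>a\<close>
  of radius comparable to \<open>1 - |a|\<close>.  This works for all exponents at once and avoids
  the subharmonicity of \<open>|h|\<^sup>p\<close>.\<close>

lemma holomorphic_powr_le_nn_integral_unit:
  fixes p :: real
  assumes p: "0 < p"
  obtains C :: real where "0 < C"
    "\<And>h. h holomorphic_on UNIV \<Longrightarrow>
       ennreal (cmod (h 0) powr p) \<le> C * (\<integral>\<^sup>+u\<in>ball 0 1. cmod (h u) powr p \<partial>lborel)"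
proof -
  \<comment> \<open>A point within \<open>s = (1 - |a|) / 2\<close> of the maximiser
    \<open>a\<close> keeps at least half the distance to the unit circle, so comparing
    \<open>|h|\<close> there with \<open>|h a|\<close> costs at most
    \<open>2 powr (2 / p)\<close>.\<close>
  define K :: real where "K = 2 powr (2 / p)"
  have K: "1 \<le> K" using p unfolding K_def by (intro ge_one_powr_ge_zero) auto
  define \<epsilon> :: real where "\<epsilon> = 1 / (4 * K)"
  have eps: "0 < \<epsilon>" "\<epsilon> \<le> 1 / 4" using K by (auto simp: \<epsilon>_def field_simps)
  \<comment> \<open>Since \<open>u a powr p = 4 * s\<^sup>2 * |h a| powr p\<close>, while
    \<open>|h|\<close> is at least \<open>|h a| / 2\<close> on a disc of area
    \<open>pi * \<epsilon>\<^sup>2 * s\<^sup>2\<close>, this is the ratio of the two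
    quantities.\<close>
  define C where "C = 4 * 2 powr p / (pi * \<epsilon>\<^sup>2)"
  have "0 < C" using eps by (simp add: C_def)
  moreover have "ennreal (cmod (h 0) powr p) \<le> C * (\<integral>\<^sup>+u\<in>ball 0 1. cmod (h u) powr p \<partial>lborel)"
    if h: "h holomorphic_on UNIV" for h
  proof (cases "h 0 = 0")
    case False
    \<comment> \<open>The exponent \<open>2 / p\<close> turns into a square after taking the power
      \<open>p\<close>, that is, into the scale of an area.\<close>
    define u where "u x = cmod (h x) * (1 - cmod x) powr (2 / p)" for x
    have cont: "continuous_on S h" for S
      using h holomorphic_on_imp_continuous_on continuous_on_subset by blast
    have "continuous_on (cball 0 1) u" unfolding u_def
      using p by (intro continuous_intros cont continuous_on_powr') auto
    then obtain a where a: "a \<in> cball 0 1" and max: "\<And>x. x \<in> cball 0 1 \<Longrightarrow> u x \<le> u a"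
      using continuous_attains_sup[of "cball 0 1 :: complex set" u] by auto
    have u0: "cmod (h 0) \<le> u a" using max[of 0] by (simp add: u_def)
    have "u a \<noteq> 0" using u0 False by auto
    then have A: "0 < cmod (h a)" and a1: "cmod a < 1"
      using a by (auto simp: u_def less_le)
    define s where "s = (1 - cmod a) / 2"
    have s: "0 < s" "1 - cmod a = 2 * s" using a1 by (auto simp: s_def)
    have leK: "cmod (h x) \<le> K * cmod (h a)" if x: "x \<in> cball a s" for x
    proof -
      have "cmod x \<le> cmod a + s" using x norm_triangle_ineq3[of x a]
        by (auto simp: dist_norm norm_minus_commute)
      then have x1: "s \<le> 1 - cmod x" using s(2) by simp
      have "cmod (h x) * s powr (2 / p) \<le> u x"
        unfolding u_def using x1 s p by (intro mult_left_mono powr_mono2) auto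
      also have "\<dots> \<le> u a" using x1 s by (intro max) auto
      also have "\<dots> = K * cmod (h a) * s powr (2 / p)"
        using s by (simp add: u_def K_def powr_mult)
      finally show ?thesis using s by simp
    qed
    have lower: "cmod (h a) / 2 \<le> cmod (h x)" if "x \<in> ball a (\<epsilon> * s)" for x
      using holomorphic_lower_bound_near[OF h s(1) K A leK] that by (simp add: \<epsilon>_def)
    have sub: "ball a (\<epsilon> * s) \<subseteq> ball 0 1"
    proof
      fix x assume "x \<in> ball a (\<epsilon> * s)"
      then have "cmod x < cmod a + \<epsilon> * s" using norm_triangle_ineq3[of x a]
        by (auto simp: dist_norm norm_minus_commute)
      moreover have "\<epsilon> * s \<le> 1 / 4 * s" using eps s by (intro mult_right_mono) auto
      ultimately have "cmod x < 1" using s by linarith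
      then show "x \<in> ball 0 1" by simp
    qed
    have em: "emeasure lborel (ball a (\<epsilon> * s)) = ennreal (pi * (\<epsilon> * s)\<^sup>2)"
      using eps s by (subst emeasure_ball) (auto simp: unit_ball_vol_2)
    have "ennreal (cmod (h 0) powr p) \<le> ennreal (u a powr p)"
      using u0 p by (intro ennreal_leI powr_mono2) auto
    also have "u a powr p = C * ((cmod (h a) / 2) powr p * (pi * (\<epsilon> * s)\<^sup>2))"
    proof -
      have "u a powr p = cmod (h a) powr p * (2 * s) powr (2 / p * p)"
        unfolding u_def s(2) using s by (simp only: powr_mult norm_ge_zero powr_ge_zero powr_powr)
      also have "(2 * s) powr (2 / p * p) = 4 * s\<^sup>2"
        using s p by (simp add: power_mult_distrib)
      also have "cmod (h a) powr p = 2 powr p * (cmod (h a) / 2) powr p"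
        by (simp add: powr_divide)
      also have "2 powr p * (cmod (h a) / 2) powr p * (4 * s\<^sup>2) =
          C * ((cmod (h a) / 2) powr p * (pi * (\<epsilon> * s)\<^sup>2))"
        using eps by (simp add: C_def power_mult_distrib)
      finally show ?thesis .
    qed
    also have "ennreal \<dots> = C * (\<integral>\<^sup>+x\<in>ball a (\<epsilon> * s). (cmod (h a) / 2) powr p \<partial>lborel)"
      using \<open>0 < C\<close> by (simp add: nn_integral_cmult_indicator em ennreal_mult)
    also have "\<dots> \<le> C * (\<integral>\<^sup>+u\<in>ball 0 1. cmod (h u) powr p \<partial>lborel)"
      using lower sub p A
      by (intro mult_left_mono nn_integral_mono) (auto simp: indicator_def intro!: powr_mono2 ennreal_leI)
    finally show ?thesis .
  qed (simp)
  ultimately show thesis by (rule that)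
qed

lemma nn_integral_lborel_translate:
  fixes c :: "'a::euclidean_space"
  assumes [measurable]: "g \<in> borel_measurable borel"
  shows "(\<integral>\<^sup>+x. g (c + x) \<partial>lborel) = (\<integral>\<^sup>+x. g x \<partial>lborel)"
  by (subst (2) lborel_distr_plus[of c, symmetric]) (simp add: nn_integral_distr)

text \<open>Expanding \<open>|z + x|\<^sup>2\<close> shows that the holomorphic twist
  \<open>exp (- (cnj z * x))\<close> moves the Gaussian weight from \<open>z\<close> to the origin.
  On the unit disc a factor of at most \<open>exp (p / 2)\<close> remains, so the constant does not
  depend on \<open>z\<close>.\<close>

lemma fock_weighted_le_nn_integral_ball:
  fixes p :: real
  assumes p: "0 < p"
  obtains C :: real where "0 < C"
    "\<And>f z. f holomorphic_on UNIV \<Longrightarrow>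
       ennreal (fock_weighted p f z) \<le> C * (\<integral>\<^sup>+u\<in>ball z 1. fock_weighted p f u \<partial>lborel)"
proof -
  obtain C :: real where C: "0 < C"
    "\<And>h. h holomorphic_on UNIV \<Longrightarrow>
       ennreal (cmod (h 0) powr p) \<le> C * (\<integral>\<^sup>+u\<in>ball 0 1. cmod (h u) powr p \<partial>lborel)"
    using holomorphic_powr_le_nn_integral_unit[OF p] by metis
  have "ennreal (fock_weighted p f z) \<le> (C * exp (p / 2)) * (\<integral>\<^sup>+u\<in>ball z 1. fock_weighted p f u \<partial>lborel)"
    if f: "f holomorphic_on UNIV" for f z
  proof -
    define h where "h x = f (z + x) * exp (- (cnj z * x))" for x
    have "(f \<circ> (\<lambda>x. z + x)) holomorphic_on UNIV"
      by (intro holomorphic_on_compose holomorphic_intros holomorphic_on_subset[OF f]) auto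
    then have h: "h holomorphic_on UNIV" unfolding h_def o_def
      by (intro holomorphic_intros)
    define e where "e = exp (- (p * (cmod z)\<^sup>2 / 2))"
    have sq: "(cmod (z + x))\<^sup>2 = (cmod z)\<^sup>2 + (cmod x)\<^sup>2 + 2 * Re (cnj z * x)" for x
      unfolding cmod_power2 by (simp add: power2_eq_square algebra_simps)
    have he: "e * cmod (h x) powr p = fock_weighted p f (z + x) * exp (p * (cmod x)\<^sup>2 / 2)" for x
    proof -
      have "e * cmod (h x) powr p = cmod (f (z + x)) powr p * (e * exp (- (p * Re (cnj z * x))))"
        by (simp add: h_def norm_mult powr_mult exp_powr_real algebra_simps)
      also have "e * exp (- (p * Re (cnj z * x))) = exp (- (p * (cmod (z + x))\<^sup>2 / 2)) * exp (p * (cmod x)\<^sup>2 / 2)"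
        unfolding e_def exp_add[symmetric] sq by (simp add: algebra_simps add_divide_distrib)
      finally show ?thesis by (simp add: fock_weighted_def mult_ac)
    qed
    have [measurable]: "fock_weighted p f \<in> borel_measurable borel" "h \<in> borel_measurable borel"
      using fock_weighted_measurable[OF f] h
      by (auto intro!: borel_measurable_continuous_onI holomorphic_on_imp_continuous_on)
    have [measurable]: "ball (x :: complex) r \<in> sets borel" for x r by simp
    have m1: "(\<lambda>u. ennreal (cmod (h u) powr p) * indicator (ball 0 1) u) \<in> borel_measurable lborel"
      and m2: "(\<lambda>u. ennreal (fock_weighted p f u) * indicator (ball z 1) u) \<in> borel_measurable lborel"
      by measurable
    have "ennreal (fock_weighted p f z) = ennreal e * ennreal (cmod (h 0) powr p)"
      using he[of 0] by (simp add: e_def flip: ennreal_mult)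
    also have "\<dots> \<le> ennreal e * (C * (\<integral>\<^sup>+u\<in>ball 0 1. cmod (h u) powr p \<partial>lborel))"
      by (intro mult_left_mono C h) auto
    also have "\<dots> = C * (\<integral>\<^sup>+u. ennreal e * (ennreal (cmod (h u) powr p) * indicator (ball 0 1) u) \<partial>lborel)"
      by (simp only: nn_integral_cmult[OF m1] mult.left_commute)
    also have "\<dots> \<le> C * (\<integral>\<^sup>+u. ennreal (exp (p / 2)) * (ennreal (fock_weighted p f (z + u)) * indicator (ball z 1) (z + u)) \<partial>lborel)"
    proof (intro mult_left_mono nn_integral_mono)
      fix u :: complex
      have "ennreal e * ennreal (cmod (h u) powr p) \<le> ennreal (exp (p / 2)) * ennreal (fock_weighted p f (z + u))"
        if "cmod u < 1"
      proof -
        have "(cmod u)\<^sup>2 \<le> 1" using that by (simp add: power_le_one)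
        then have "exp (p * (cmod u)\<^sup>2 / 2) \<le> exp (p / 2)" using p by simp
        then have "e * cmod (h u) powr p \<le> exp (p / 2) * fock_weighted p f (z + u)"
          unfolding he by (subst mult.commute) (intro mult_right_mono fock_weighted_nonneg)
        then have "ennreal (e * cmod (h u) powr p) \<le> ennreal (exp (p / 2) * fock_weighted p f (z + u))"
          by (rule ennreal_leI)
        then show ?thesis by (simp only: ennreal_mult e_def exp_ge_zero powr_ge_zero fock_weighted_nonneg)
      qed
      then show "ennreal e * (ennreal (cmod (h u) powr p) * indicator (ball 0 1) u) \<le>
          ennreal (exp (p / 2)) * (ennreal (fock_weighted p f (z + u)) * indicator (ball z 1) (z + u))"
        by (cases "cmod u < 1") (simp_all add: dist_norm)
    qed simp
    also have "\<dots> = C * (\<integral>\<^sup>+u. ennreal (exp (p / 2)) * (ennreal (fock_weighted p f u) * indicator (ball z 1) u) \<partial>lborel)"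
      using nn_integral_lborel_translate[of "\<lambda>u. ennreal (exp (p / 2)) *
        (ennreal (fock_weighted p f u) * indicator (ball z 1) u)" z] by simp
    also have "\<dots> = (C * exp (p / 2)) * (\<integral>\<^sup>+u\<in>ball z 1. fock_weighted p f u \<partial>lborel)"
      using C(1) by (simp only: nn_integral_cmult[OF m2] ennreal_mult less_imp_le exp_ge_zero mult.assoc)
    finally show ?thesis .
  qed
  then show thesis using that[of "C * exp (p / 2)"] C(1) by simp
qed

text \<open>Taking values in \<open>ennreal\<close> removes integrability side conditions:
  membership is finiteness. Neither root nor normalisation is kept, so the unit ball becomes the
  bound \<open>2 * pi / p\<close>.\<close>

definition fock_mass :: "real \<Rightarrow> (complex \<Rightarrow> complex) \<Rightarrow> ennreal" where
  "fock_mass p f = (\<integral>\<^sup>+z. fock_weighted p f z \<partial>lborel)"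

lemma fock_space_iff_mass:
  "f \<in> fock_space p \<longleftrightarrow> f holomorphic_on UNIV \<and> fock_mass p f < \<infinity>"
proof -
  have "integrable lborel (fock_weighted p f) \<longleftrightarrow> fock_mass p f < \<infinity>" if "f holomorphic_on UNIV"
    using fock_weighted_measurable[OF that]
    by (simp add: integrable_iff_bounded fock_mass_def fock_weighted_nonneg)
  then show ?thesis by (auto simp: fock_space_def)
qed

lemma fock_mass_eq_integral:
  assumes "f \<in> fock_space p"
  shows "fock_mass p f = ennreal (LINT z|lborel. fock_weighted p f z)"
  unfolding fock_mass_def using assms
  by (intro nn_integral_eq_integral) (auto simp: fock_space_def fock_weighted_nonneg)

lemma fock_mass_eq_norm:
  assumes "0 < p" "f \<in> fock_space p"
  shows "fock_mass p f = ennreal (2 * pi / p * fock_norm p f powr p)"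
  using assms by (simp add: fock_mass_eq_integral fock_norm_powr)

lemma fock_unit_ball_iff_mass:
  assumes p: "0 < p"
  shows "f \<in> fock_unit_ball p \<longleftrightarrow> f holomorphic_on UNIV \<and> fock_mass p f \<le> ennreal (2 * pi / p)"
proof -
  have "fock_norm p f \<le> 1 \<longleftrightarrow> fock_mass p f \<le> ennreal (2 * pi / p)" if f: "f \<in> fock_space p"
  proof -
    have n0: "0 \<le> fock_norm p f" by (simp add: fock_norm_def)
    have "fock_norm p f \<le> 1 \<longleftrightarrow> fock_norm p f powr p \<le> 1"
      using p n0 powr_mono2[of p "fock_norm p f" 1] powr_less_mono2[of p 1 "fock_norm p f"]
      by (cases "fock_norm p f \<le> 1") (simp_all add: not_le)
    also have "\<dots> \<longleftrightarrow> 2 * pi / p * fock_norm p f powr p \<le> 2 * pi / p"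
      using p by (simp add: field_simps)
    also have "\<dots> \<longleftrightarrow> fock_mass p f \<le> ennreal (2 * pi / p)"
      unfolding fock_mass_eq_norm[OF p f] using p by (subst ennreal_le_iff) auto
    finally show ?thesis .
  qed
  moreover have "fock_mass p f < \<infinity>" if "fock_mass p f \<le> ennreal (2 * pi / p)"
    using that by (rule order_le_less_trans) simp
  ultimately show ?thesis by (auto simp: fock_unit_ball_def fock_space_iff_mass)
qed

lemma fock_weighted_le_mass:
  fixes p :: real
  assumes p: "0 < p"
  obtains C :: real where "0 < C"
    "\<And>f z. f holomorphic_on UNIV \<Longrightarrow> ennreal (fock_weighted p f z) \<le> C * fock_mass p f"
proof -
  obtain C :: real where C: "0 < C" "\<And>f z. f holomorphic_on UNIV \<Longrightarrow>
       ennreal (fock_weighted p f z) \<le> C * (\<integral>\<^sup>+u\<in>ball z 1. fock_weighted p f u \<partial>lborel)"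
    using fock_weighted_le_nn_integral_ball[OF p] by metis
  have "ennreal (fock_weighted p f z) \<le> C * fock_mass p f" if "f holomorphic_on UNIV" for f z
    using C(2)[OF that]
  proof (rule order_trans)
    show "C * (\<integral>\<^sup>+u\<in>ball z 1. fock_weighted p f u \<partial>lborel) \<le> C * fock_mass p f"
      unfolding fock_mass_def
      by (intro mult_left_mono nn_integral_mono) (simp_all add: indicator_def)
  qed
  with C(1) show thesis by (rule that)
qed

lemma fock_weighted_eq_powr: "fock_weighted p f z = (cmod (f z) * exp (- ((cmod z)\<^sup>2 / 2))) powr p"
  by (simp add: fock_weighted_def powr_mult exp_powr_real)

lemma fock_weighted_powr:
  assumes "0 < p"
  shows "fock_weighted q f z = fock_weighted p f z powr (q / p)"
  using assms by (simp add: fock_weighted_eq_powr powr_powr)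

text \<open>The uniform bound on point evaluations controls the surplus power
  \<open>q / p - 1\<close> of the integrand, leaving the integral for \<open>p\<close>.\<close>

lemma fock_mass_mono_exponent:
  fixes p q B :: real
  assumes p: "0 < p" and q: "p \<le> q"
  obtains D :: real where "0 \<le> D"
    "\<And>f. f holomorphic_on UNIV \<Longrightarrow> fock_mass p f \<le> ennreal B \<Longrightarrow> fock_mass q f \<le> ennreal D"
proof -
  obtain C :: real where C: "0 < C"
    "\<And>f z. f holomorphic_on UNIV \<Longrightarrow> ennreal (fock_weighted p f z) \<le> C * fock_mass p f"
    using fock_weighted_le_mass[OF p] by metis
  \<comment> \<open>\<open>ennreal\<close> sends negative reals to 0, so \<open>B\<close> may be
    replaced by its positive part.\<close>
  define B' where "B' = max 0 B"
  define E where "E = (C * B') powr (q / p - 1)"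
  have B': "0 \<le> B'" "ennreal B = ennreal B'" by (auto simp: B'_def max_def ennreal_neg)
  have "fock_mass q f \<le> ennreal (E * B')"
    if f: "f holomorphic_on UNIV" and le: "fock_mass p f \<le> ennreal B" for f
  proof -
    have [measurable]: "fock_weighted p f \<in> borel_measurable lborel"
      using f by (rule fock_weighted_measurable)
    have pt: "fock_weighted q f z \<le> E * fock_weighted p f z" for z
    proof -
      have "ennreal (fock_weighted p f z) \<le> C * fock_mass p f" using f by (rule C)
      also have "\<dots> \<le> ennreal C * ennreal B'" using le B' by (intro mult_left_mono) auto
      finally have "ennreal (fock_weighted p f z) \<le> ennreal (C * B')"
        using C(1) B' by (simp add: ennreal_mult)
      then have le: "fock_weighted p f z \<le> C * B'" using C(1) B' by (subst (asm) ennreal_le_iff) auto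
      have "fock_weighted q f z = fock_weighted p f z powr (q / p - 1) * fock_weighted p f z"
        using p fock_weighted_nonneg[of p f z]
        by (cases "fock_weighted p f z = 0") (simp_all add: fock_weighted_powr[of p q] powr_diff)
      also have "\<dots> \<le> E * fock_weighted p f z" unfolding E_def
        using p q le fock_weighted_nonneg[of p f z] by (intro mult_right_mono powr_mono2) auto
      finally show ?thesis .
    qed
    have "fock_mass q f \<le> (\<integral>\<^sup>+z. ennreal E * fock_weighted p f z \<partial>lborel)"
      unfolding fock_mass_def
    proof (intro nn_integral_mono)
      fix z
      have "ennreal (fock_weighted q f z) \<le> ennreal (E * fock_weighted p f z)"
        using pt by (rule ennreal_leI)
      then show "ennreal (fock_weighted q f z) \<le> ennreal E * fock_weighted p f z"
        by (simp only: ennreal_mult E_def powr_ge_zero fock_weighted_nonneg)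
    qed
    also have "\<dots> = ennreal E * fock_mass p f"
      unfolding fock_mass_def by (rule nn_integral_cmult) measurable
    also have "\<dots> \<le> ennreal E * ennreal B'" using le B' by (intro mult_left_mono) auto
    finally show ?thesis using B' by (simp add: ennreal_mult E_def)
  qed
  moreover have "0 \<le> E * B'" using B' by (simp add: E_def)
  ultimately show thesis using that by metis
qed

lemma fock_space_mono:
  assumes p: "0 < p" and q: "p \<le> q"
  shows "fock_space p \<subseteq> fock_space q"
proof
  fix f assume "f \<in> fock_space p"
  then have f: "f holomorphic_on UNIV" "fock_mass p f < \<infinity>" by (auto simp: fock_space_iff_mass)
  then obtain B where "fock_mass p f = ennreal B" by (cases "fock_mass p f") auto
  moreover obtain D :: real where
    "\<And>f. f holomorphic_on UNIV \<Longrightarrow> fock_mass p f \<le> ennreal B \<Longrightarrow> fock_mass q f \<le> ennreal D"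
    using fock_mass_mono_exponent[OF p q] by metis
  ultimately have "fock_mass q f \<le> ennreal D" using f by simp
  also have "\<dots> < \<infinity>" by simp
  finally show "f \<in> fock_space q" using f by (simp add: fock_space_iff_mass)
qed

text \<open>By the local estimate and Tonelli's theorem; this avoids the transformation formula for
  complex-linear maps.\<close>

lemma nn_integral_fock_weighted_affine:
  fixes a b :: complex and q :: real
  assumes q: "0 < q" and a: "a \<noteq> 0"
  obtains K :: real where "0 \<le> K"
    "\<And>f. f holomorphic_on UNIV \<Longrightarrow>
       (\<integral>\<^sup>+z. fock_weighted q f (a * z + b) \<partial>lborel) \<le> K * fock_mass q f"
proof -
  obtain C :: real where C: "0 < C" "\<And>f z. f holomorphic_on UNIV \<Longrightarrow>
       ennreal (fock_weighted q f z) \<le> C * (\<integral>\<^sup>+u\<in>ball z 1. fock_weighted q f u \<partial>lborel)"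
    using fock_weighted_le_nn_integral_ball[OF q] by metis
  \<comment> \<open>For fixed \<open>u\<close>, the points \<open>z\<close> with
    \<open>|a * z + b - u| < 1\<close> form a disc of area \<open>pi / |a|\<^sup>2\<close>; this is
    the inner integral after the order of integration is exchanged.\<close>
  define K where "K = C * (pi / (cmod a)\<^sup>2)"
  have "(\<integral>\<^sup>+z. fock_weighted q f (a * z + b) \<partial>lborel) \<le> K * fock_mass q f"
    if f: "f holomorphic_on UNIV" for f
  proof -
    have [measurable]: "fock_weighted q f \<in> borel_measurable borel"
      using fock_weighted_measurable[OF f] by simp
    define F where "F z u = ennreal (fock_weighted q f u) * indicator {v. cmod (a * z + b - v) < 1} u" for z u
    have F_meas [measurable]: "case_prod F \<in> borel_measurable (lborel \<Otimes>\<^sub>M lborel)"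
    proof -
      have "case_prod F = (\<lambda>x. ennreal (fock_weighted q f (snd x)) *
          (if cmod (a * fst x + b - snd x) < 1 then 1 else 0))"
        by (auto simp: F_def indicator_def)
      then show ?thesis by simp
    qed
    have inner: "(\<integral>\<^sup>+z. F z u \<partial>lborel) = ennreal (pi / (cmod a)\<^sup>2) * fock_weighted q f u" for u
    proof -
      have "a * z + b - u = a * (z - (u - b) / a)" for z
        using a by (simp add: divide_simps)
      then have eq: "cmod (a * z + b - u) = cmod a * dist ((u - b) / a) z" for z
        by (simp only: norm_mult dist_norm norm_minus_commute)
      have "cmod (a * z + b - u) < 1 \<longleftrightarrow> z \<in> ball ((u - b) / a) (1 / cmod a)" for z
        unfolding eq using a by (simp add: pos_less_divide_eq mult.commute)
      then have "F z u = ennreal (fock_weighted q f u) * indicator (ball ((u - b) / a) (1 / cmod a)) z" for z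
        by (simp add: F_def indicator_def)
      then have "(\<integral>\<^sup>+z. F z u \<partial>lborel) =
          ennreal (fock_weighted q f u) * emeasure lborel (ball ((u - b) / a) (1 / cmod a))"
        by (simp add: nn_integral_cmult_indicator)
      also have "emeasure lborel (ball ((u - b) / a) (1 / cmod a)) = ennreal (pi / (cmod a)\<^sup>2)"
        using a by (subst emeasure_ball) (auto simp: unit_ball_vol_2 power_divide)
      finally show ?thesis by (simp add: mult.commute)
    qed
    have "(\<integral>\<^sup>+z. fock_weighted q f (a * z + b) \<partial>lborel) \<le> (\<integral>\<^sup>+z. C * (\<integral>\<^sup>+u. F z u \<partial>lborel) \<partial>lborel)"
    proof (intro nn_integral_mono)
      fix z
      have "(\<integral>\<^sup>+u\<in>ball (a * z + b) 1. fock_weighted q f u \<partial>lborel) = (\<integral>\<^sup>+u. F z u \<partial>lborel)"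
        by (intro nn_integral_cong) (simp add: F_def indicator_def dist_norm)
      then show "ennreal (fock_weighted q f (a * z + b)) \<le> C * (\<integral>\<^sup>+u. F z u \<partial>lborel)"
        using C(2)[OF f, of "a * z + b"] by simp
    qed
    also have "\<dots> = C * (\<integral>\<^sup>+z. (\<integral>\<^sup>+u. F z u \<partial>lborel) \<partial>lborel)"
      by (rule nn_integral_cmult) measurable
    also have "(\<integral>\<^sup>+z. (\<integral>\<^sup>+u. F z u \<partial>lborel) \<partial>lborel) = (\<integral>\<^sup>+u. (\<integral>\<^sup>+z. F z u \<partial>lborel) \<partial>lborel)"
      by (rule pair_sigma_finite.Fubini'[symmetric])
         (use F_meas in \<open>auto intro: pair_sigma_finite.intro sigma_finite_lborel\<close>)
    also have "\<dots> = ennreal (pi / (cmod a)\<^sup>2) * fock_mass q f"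
      unfolding inner fock_mass_def by (rule nn_integral_cmult) measurable
    finally show ?thesis
      using C(1) by (simp add: K_def ennreal_mult mult.assoc del: times_divide_eq_right)
  qed
  moreover have "0 \<le> K" using C(1) by (simp add: K_def)
  ultimately show thesis using that by metis
qed

section \<open>Gaussian integrals and the normalised reproducing kernels\<close>

lemma nn_integral_gaussian_real:
  fixes p :: real
  assumes p: "0 < p"
  shows "(\<integral>\<^sup>+x. exp (- (p * x\<^sup>2 / 2)) \<partial>lborel) = ennreal (sqrt (2 * pi / p))"
proof -
  define \<sigma> where "\<sigma> = 1 / sqrt p"
  have \<sigma>: "\<sigma>\<^sup>2 = 1 / p" using p by (simp add: \<sigma>_def power_divide)
  have eq: "exp (- (p * x\<^sup>2 / 2)) = sqrt (2 * pi / p) * normal_density 0 \<sigma> x" for x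
    using p by (simp add: normal_density_def \<sigma> real_sqrt_divide)
  have "(\<integral>\<^sup>+x. exp (- (p * x\<^sup>2 / 2)) \<partial>lborel) = (\<integral>x. exp (- (p * x\<^sup>2 / 2)) \<partial>lborel)"
    using p by (intro nn_integral_eq_integral) (auto simp: eq \<sigma>_def)
  also have "\<dots> = ennreal (sqrt (2 * pi / p))"
    unfolding eq using p by (simp add: \<sigma>_def)
  finally show ?thesis .
qed

lemma nn_integral_gaussian_complex:
  fixes p :: real
  assumes p: "0 < p"
  shows "(\<integral>\<^sup>+z. exp (- (p * (cmod z)\<^sup>2 / 2)) \<partial>lborel) = ennreal (2 * pi / p)"
proof -
  have "(\<integral>\<^sup>+z. (\<Prod>b\<in>Basis. (\<lambda>b x. ennreal (exp (- (p * x\<^sup>2 / 2)))) b ((z :: complex) \<bullet> b)) \<partial>lborel) =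
      (\<Prod>b\<in>(Basis :: complex set). (\<integral>\<^sup>+x. exp (- (p * x\<^sup>2 / 2)) \<partial>lborel))"
    by (rule nn_integral_lborel_prod) auto
  also have "\<dots> = ennreal (sqrt (2 * pi / p) * sqrt (2 * pi / p))"
    using p by (simp add: nn_integral_gaussian_real Basis_complex_def del: real_sqrt_divide flip: ennreal_mult)
  also have "sqrt (2 * pi / p) * sqrt (2 * pi / p) = 2 * pi / p" using p by simp
  also have "(\<integral>\<^sup>+z. (\<Prod>b\<in>Basis. (\<lambda>b x. ennreal (exp (- (p * x\<^sup>2 / 2)))) b ((z :: complex) \<bullet> b)) \<partial>lborel) =
      (\<integral>\<^sup>+z. exp (- (p * (cmod z)\<^sup>2 / 2)) \<partial>lborel)"
    by (intro nn_integral_cong)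
       (simp add: Basis_complex_def cmod_power2 distrib_left add_divide_distrib
         flip: ennreal_mult exp_add)
  finally show ?thesis .
qed

text \<open>The reproducing kernel \<open>exp (cnj w * z)\<close> of the Hilbert space case
  \<open>p = 2\<close>, divided by its norm. This one normalisation gives norm 1 for every
  exponent.\<close>

definition fock_kernel :: "complex \<Rightarrow> complex \<Rightarrow> complex" where
  "fock_kernel w z = exp (cnj w * z - (cmod w)\<^sup>2 / 2)"

lemma fock_kernel_holomorphic: "fock_kernel w holomorphic_on UNIV"
  unfolding fock_kernel_def by (intro holomorphic_intros)

lemma cmod_fock_kernel: "cmod (fock_kernel w z) = exp ((cmod z)\<^sup>2 / 2 - (cmod (z - w))\<^sup>2 / 2)"
proof -
  have "(cmod (z - w))\<^sup>2 = (cmod z)\<^sup>2 + (cmod w)\<^sup>2 - 2 * Re (cnj w * z)"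
    unfolding cmod_power2 by (simp add: power2_eq_square algebra_simps)
  moreover have "Re (cnj w * z - (cmod w)\<^sup>2 / 2) = Re (cnj w * z) - (cmod w)\<^sup>2 / 2"
    by simp
  ultimately show ?thesis
    unfolding fock_kernel_def norm_exp_eq_Re by (simp add: field_simps)
qed

text \<open>By \<open>cmod_fock_kernel\<close> the weighted kernel is a Gaussian centred at
  \<open>w\<close>, so translation removes the dependence on \<open>w\<close>.\<close>

lemma fock_mass_kernel:
  assumes p: "0 < p"
  shows "fock_mass p (fock_kernel w) = ennreal (2 * pi / p)"
proof -
  have "fock_weighted p (fock_kernel w) (w + z) = exp (- (p * (cmod z)\<^sup>2 / 2))" for z
    by (simp add: fock_weighted_eq_powr cmod_fock_kernel exp_powr_real flip: exp_add)
  moreover have "(\<lambda>z. ennreal (fock_weighted p (fock_kernel w) z)) \<in> borel_measurable borel"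
    using fock_weighted_measurable[OF fock_kernel_holomorphic] by simp
  ultimately show ?thesis
    unfolding fock_mass_def using nn_integral_gaussian_complex[OF p]
    by (subst nn_integral_lborel_translate[of _ w, symmetric]) auto
qed

lemma fock_kernel_in_unit_ball: "0 < p \<Longrightarrow> fock_kernel w \<in> fock_unit_ball p"
  by (simp add: fock_unit_ball_iff_mass fock_kernel_holomorphic fock_mass_kernel)

section \<open>Separation of the symbols\<close>

text \<open>The factor relating \<open>|W f|\<close> times the Gaussian at \<open>z\<close> to
  \<open>|f|\<close> times the Gaussian at \<open>\<phi> z\<close>; see
  \<open>fock_weighted_weighted_comp\<close>.\<close>

definition symbol_weight :: "(complex \<Rightarrow> complex) \<Rightarrow> (complex \<Rightarrow> complex) \<Rightarrow> complex \<Rightarrow> real" where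
  "symbol_weight \<psi> \<phi> z = cmod (\<psi> z) * exp (((cmod (\<phi> z))\<^sup>2 - (cmod z)\<^sup>2) / 2)"

lemma symbol_weight_nonneg: "0 \<le> symbol_weight \<psi> \<phi> z"
  by (simp add: symbol_weight_def)

text \<open>Written out in terms of the symbols, so that the analysis of this section is free of
  function spaces and operators.\<close>

definition kernel_gap ::
    "(complex \<Rightarrow> complex) \<Rightarrow> (complex \<Rightarrow> complex) \<Rightarrow> (complex \<Rightarrow> complex) \<Rightarrow> (complex \<Rightarrow> complex)
      \<Rightarrow> complex \<Rightarrow> complex \<Rightarrow> real" where
  "kernel_gap \<psi>1 \<phi>1 \<psi>2 \<phi>2 w z =
     cmod (\<psi>1 z * fock_kernel w (\<phi>1 z) - \<psi>2 z * fock_kernel w (\<phi>2 z)) * exp (- ((cmod z)\<^sup>2 / 2))"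

lemma kernel_gap_swap: "kernel_gap \<psi>2 \<phi>2 \<psi>1 \<phi>1 = kernel_gap \<psi>1 \<phi>1 \<psi>2 \<phi>2"
  by (simp add: kernel_gap_def norm_minus_commute fun_eq_iff)

text \<open>The weighted kernel centred at \<open>\<phi>1 z\<close> is at its peak value 1 at that
  point, so the first operator contributes its full weight; at \<open>\<phi>2 z\<close> it has
  decayed by the Gaussian of the distance.\<close>

lemma symbol_weight_le_kernel_gap:
  "symbol_weight \<psi>1 \<phi>1 z \<le> kernel_gap \<psi>1 \<phi>1 \<psi>2 \<phi>2 (\<phi>1 z) z
     + exp (- ((cmod (\<phi>1 z - \<phi>2 z))\<^sup>2 / 2)) * symbol_weight \<psi>2 \<phi>2 z"
proof -
  define e where "e = exp (- ((cmod z)\<^sup>2 / 2))"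
  have 1: "cmod (\<psi>1 z * fock_kernel (\<phi>1 z) (\<phi>1 z)) * e = symbol_weight \<psi>1 \<phi>1 z"
    by (simp add: norm_mult cmod_fock_kernel symbol_weight_def e_def mult.assoc diff_divide_distrib flip: exp_add)
  have 2: "cmod (\<psi>2 z * fock_kernel (\<phi>1 z) (\<phi>2 z)) * e
      = exp (- ((cmod (\<phi>1 z - \<phi>2 z))\<^sup>2 / 2)) * symbol_weight \<psi>2 \<phi>2 z"
    by (simp add: norm_mult cmod_fock_kernel symbol_weight_def e_def mult.assoc mult.left_commute
        diff_divide_distrib norm_minus_commute[of "\<phi>2 z"] algebra_simps flip: exp_add)
  have "cmod (\<psi>1 z * fock_kernel (\<phi>1 z) (\<phi>1 z)) * e \<le> kernel_gap \<psi>1 \<phi>1 \<psi>2 \<phi>2 (\<phi>1 z) z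
      + cmod (\<psi>2 z * fock_kernel (\<phi>1 z) (\<phi>2 z)) * e"
    unfolding kernel_gap_def e_def[symmetric] distrib_right[symmetric]
    using norm_triangle_sub[of "\<psi>1 z * fock_kernel (\<phi>1 z) (\<phi>1 z)" "\<psi>2 z * fock_kernel (\<phi>1 z) (\<phi>2 z)"]
    by (intro mult_right_mono) (auto simp: e_def)
  then show ?thesis unfolding 1 2 .
qed

text \<open>Inserting one of the two kernel inequalities into the other leaves
  \<open>m1 * (1 - exp (- d\<^sup>2))\<close> bounded by \<open>2 * E\<close>. The undivided form
  stays valid where the symbols agree.\<close>

lemma symbol_weight_separation:
  fixes z :: complex and \<phi>1 \<phi>2 :: "complex \<Rightarrow> complex"
  defines "d \<equiv> cmod (\<phi>1 z - \<phi>2 z)"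
  assumes E: "kernel_gap \<psi>1 \<phi>1 \<psi>2 \<phi>2 (\<phi>1 z) z \<le> E" "kernel_gap \<psi>1 \<phi>1 \<psi>2 \<phi>2 (\<phi>2 z) z \<le> E"
  shows "symbol_weight \<psi>1 \<phi>1 z * d\<^sup>2 \<le> 2 * E * (1 + d\<^sup>2)"
proof -
  define e where "e = exp (- (d\<^sup>2 / 2))"
  define m1 m2 where "m1 = symbol_weight \<psi>1 \<phi>1 z" and "m2 = symbol_weight \<psi>2 \<phi>2 z"
  have m: "0 \<le> m1" "0 \<le> m2" by (simp_all add: m1_def m2_def symbol_weight_nonneg)
  have e: "0 < e" "e \<le> 1" by (simp_all add: e_def)
  have E0: "0 \<le> E" using E(1) by (rule order_trans[rotated]) (simp add: kernel_gap_def)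
  have 1: "m1 \<le> E + e * m2"
    using symbol_weight_le_kernel_gap[of \<psi>1 \<phi>1 z \<psi>2 \<phi>2] E(1) by (simp add: m1_def m2_def e_def d_def)
  have 2: "m2 \<le> E + e * m1"
    using symbol_weight_le_kernel_gap[of \<psi>2 \<phi>2 z \<psi>1 \<phi>1] E(2)
    by (simp add: m1_def m2_def e_def d_def kernel_gap_swap norm_minus_commute)
  have "e * m2 \<le> e * (E + e * m1)" using 2 e by (intro mult_left_mono) auto
  also have "e * (E + e * m1) \<le> E + e * e * m1" using e E0 mult_right_mono[of e 1 E] by (simp add: algebra_simps)
  finally have "m1 * (1 - e * e) \<le> 2 * E" using 1 by (simp add: algebra_simps)
  \<comment> \<open>Equivalent to \<open>1 + d\<^sup>2 \<le> exp (d\<^sup>2)\<close>, because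
    \<open>e * e = exp (- d\<^sup>2)\<close>.\<close>
  moreover have "d\<^sup>2 \<le> (1 - e * e) * (1 + d\<^sup>2)"
  proof -
    have "e * e * (1 + d\<^sup>2) \<le> e * e * exp (d\<^sup>2)"
      using exp_ge_add_one_self[of "d\<^sup>2"] by (intro mult_left_mono) auto
    also have "\<dots> = 1" by (simp add: e_def flip: exp_add)
    finally show ?thesis by (simp add: algebra_simps)
  qed
  then have "m1 * d\<^sup>2 \<le> m1 * (1 - e * e) * (1 + d\<^sup>2)"
    using m by (simp add: mult_left_mono mult.assoc)
  ultimately show ?thesis
    using mult_right_mono[of "m1 * (1 - e * e)" "2 * E" "1 + d\<^sup>2"] by (simp add: m1_def)
qed

text \<open>With the zeros at the origin split off, both cofactors are nonzero near 0, so the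
  product does not vanish on a small punctured disc.\<close>

lemma entire_nonzero_mult:
  fixes f g :: "complex \<Rightarrow> complex"
  assumes f: "f holomorphic_on UNIV" "f \<noteq> (\<lambda>z. 0)" and g: "g holomorphic_on UNIV" "g \<noteq> (\<lambda>z. 0)"
  shows "(\<lambda>z. f z * g z) \<noteq> (\<lambda>z. 0)"
proof
  assume zero: "(\<lambda>z. f z * g z) = (\<lambda>z. 0)"
  obtain n f' where f': "f' holomorphic_on UNIV" "f' 0 \<noteq> 0" "\<And>z. f z = z ^ n * f' z"
    using entire_factor_zero[OF f] by metis
  obtain m g' where g': "g' holomorphic_on UNIV" "g' 0 \<noteq> 0" "\<And>z. g z = z ^ m * g' z"
    using entire_factor_zero[OF g] by metis
  have "isCont (\<lambda>z. f' z * g' z) 0"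
    using f'(1) g'(1) by (intro continuous_intros)
      (metis UNIV_I continuous_on_eq_continuous_at holomorphic_on_imp_continuous_on open_UNIV)+
  then have "\<forall>\<^sub>F z in at 0. f' z * g' z \<noteq> 0"
    using f'(2) g'(2) by (intro tendsto_imp_eventually_ne[of _ "f' 0 * g' 0"]) (auto simp: isCont_def)
  moreover have "\<forall>\<^sub>F z in at (0 :: complex). z \<noteq> 0"
    by (rule eventually_neq_at_within)
  ultimately have "\<forall>\<^sub>F z in at (0 :: complex). f z * g z \<noteq> 0"
    by eventually_elim (simp add: f'(3) g'(3))
  then obtain z where "f z * g z \<noteq> 0"
    using eventually_happens' trivial_limit_at by blast
  then show False using fun_cong[OF zero, of z] by simp
qed

lemma kernel_gap_bounded_imp_affine:
  assumes psi: "\<psi>1 holomorphic_on UNIV" "\<psi>2 holomorphic_on UNIV"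
    and phi: "\<phi>1 holomorphic_on UNIV" "\<phi>2 holomorphic_on UNIV"
    and nz: "\<psi>1 \<noteq> (\<lambda>z. 0)" "\<psi>2 \<noteq> (\<lambda>z. 0)" "\<phi>1 \<noteq> \<phi>2"
    and E: "\<And>w z. kernel_gap \<psi>1 \<phi>1 \<psi>2 \<phi>2 w z \<le> E"
  obtains a b where "\<And>z. \<phi>1 z = a * z + b"
proof -
  \<comment> \<open>Each of the two separation estimates brings \<open>d\<^sup>2\<close>, hence the
    fourth power. It is grouped in pairs for repeated use of
    \<open>entire_nonzero_mult\<close>.\<close>
  define g where "g z = \<psi>1 z * \<psi>2 z * (((\<phi>1 z - \<phi>2 z) * (\<phi>1 z - \<phi>2 z)) * ((\<phi>1 z - \<phi>2 z) * (\<phi>1 z - \<phi>2 z)))" for z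
  have g: "g holomorphic_on UNIV" unfolding g_def by (intro holomorphic_intros psi phi)
  have "(\<lambda>z. \<phi>1 z - \<phi>2 z) \<noteq> (\<lambda>z. 0)" using nz(3) by (auto simp: fun_eq_iff)
  then have g_nz: "g \<noteq> (\<lambda>z. 0)" unfolding g_def
    by (intro entire_nonzero_mult holomorphic_intros psi phi nz)
  have E0: "0 \<le> E" using E[of 0 0] by (rule order_trans[rotated]) (simp add: kernel_gap_def)
  have growth: "cmod (g z) * exp ((cmod (\<phi>1 z))\<^sup>2 / 4) \<le> 1024 * E\<^sup>2 * exp ((cmod z)\<^sup>2)" for z
  proof -
    define d where "d = cmod (\<phi>1 z - \<phi>2 z)"
    define A where "A = (cmod (\<phi>1 z))\<^sup>2 + (cmod (\<phi>2 z))\<^sup>2"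
    define m1 m2 where "m1 = symbol_weight \<psi>1 \<phi>1 z" and "m2 = symbol_weight \<psi>2 \<phi>2 z"
    have 1: "m1 * d\<^sup>2 \<le> 2 * E * (1 + d\<^sup>2)"
      using symbol_weight_separation[of \<psi>1 \<phi>1 \<psi>2 \<phi>2 z E] E by (simp add: m1_def d_def)
    have 2: "m2 * d\<^sup>2 \<le> 2 * E * (1 + d\<^sup>2)"
      using symbol_weight_separation[of \<psi>2 \<phi>2 \<psi>1 \<phi>1 z E] E
      by (simp add: m2_def d_def kernel_gap_swap norm_minus_commute)
    have m: "0 \<le> m1" "0 \<le> m2" by (simp_all add: m1_def m2_def symbol_weight_nonneg)
    have A0: "0 \<le> A" by (simp add: A_def)
    have "d\<^sup>2 \<le> (cmod (\<phi>1 z) + cmod (\<phi>2 z))\<^sup>2"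
      unfolding d_def by (intro power_mono norm_triangle_ineq4) auto
    also have "\<dots> \<le> 2 * A" using zero_le_power2[of "cmod (\<phi>1 z) - cmod (\<phi>2 z)"]
      by (simp add: A_def power2_sum power2_diff)
    \<comment> \<open>From \<open>1 + 2 * A \<le> 16 * (1 + A / 8)\<close>. Two such factors cost
      \<open>exp (A / 4)\<close>, half of the available \<open>exp (A / 2)\<close>, and produce the
      constant \<open>1024 = (2 * 16)\<^sup>2\<close>.\<close>
    finally have dA: "1 + d\<^sup>2 \<le> 16 * exp (A / 8)"
      using exp_ge_add_one_self[of "A / 8"] A0 by argo
    have "cmod (g z) * exp (A / 2) = exp ((cmod z)\<^sup>2) * ((m1 * d\<^sup>2) * (m2 * d\<^sup>2))"
    proof -
      have "exp (A / 2) = exp ((cmod z)\<^sup>2) * (exp (((cmod (\<phi>1 z))\<^sup>2 - (cmod z)\<^sup>2) / 2)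
          * exp (((cmod (\<phi>2 z))\<^sup>2 - (cmod z)\<^sup>2) / 2))"
        unfolding exp_add[symmetric] by (simp add: A_def field_simps)
      moreover have "cmod (g z) = cmod (\<psi>1 z) * cmod (\<psi>2 z) * (d\<^sup>2 * d\<^sup>2)"
        by (simp add: g_def d_def norm_mult power2_eq_square)
      ultimately show ?thesis by (simp add: m1_def m2_def symbol_weight_def mult_ac)
    qed
    also have "\<dots> \<le> exp ((cmod z)\<^sup>2) * ((2 * E * (1 + d\<^sup>2)) * (2 * E * (1 + d\<^sup>2)))"
      using m E0 by (intro mult_left_mono mult_mono[OF 1 2]) auto
    also have "\<dots> \<le> exp ((cmod z)\<^sup>2) * ((2 * E * (16 * exp (A / 8))) * (2 * E * (16 * exp (A / 8))))"
    proof -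
      have "2 * E * (1 + d\<^sup>2) \<le> 2 * E * (16 * exp (A / 8))"
        using E0 dA by (intro mult_left_mono) auto
      from mult_mono[OF this this] show ?thesis using E0 by (intro mult_left_mono) auto
    qed
    also have "\<dots> = 1024 * E\<^sup>2 * exp ((cmod z)\<^sup>2) * exp (A / 4)"
    proof -
      have "exp (A / 4) = exp (A / 8) * exp (A / 8)" by (simp flip: exp_add)
      then show ?thesis by (simp add: power2_eq_square)
    qed
    finally have *: "cmod (g z) * exp (A / 2) \<le> 1024 * E\<^sup>2 * exp ((cmod z)\<^sup>2) * exp (A / 4)" .
    have "exp (A / 2) = exp (A / 4) * exp (A / 4)" by (simp flip: exp_add)
    with * have "(cmod (g z) * exp (A / 4)) * exp (A / 4) \<le> (1024 * E\<^sup>2 * exp ((cmod z)\<^sup>2)) * exp (A / 4)"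
      by (simp add: mult.assoc)
    then have "cmod (g z) * exp (A / 4) \<le> 1024 * E\<^sup>2 * exp ((cmod z)\<^sup>2)"
      by (rule mult_right_le_imp_le) simp
    moreover have "cmod (g z) * exp ((cmod (\<phi>1 z))\<^sup>2 / 4) \<le> cmod (g z) * exp (A / 4)"
      by (intro mult_left_mono) (auto simp: A_def)
    ultimately show ?thesis by linarith
  qed
  show thesis using growth_imp_affine[OF g g_nz phi(1) growth] that by metis
qed

lemma affine_bounded_away:
  fixes a b :: complex
  assumes "a \<noteq> 0 \<or> b \<noteq> 0"
  obtains R \<delta> where "0 < \<delta>" "\<And>z. R \<le> cmod z \<Longrightarrow> \<delta> \<le> cmod (a * z + b)"
proof (cases "a = 0")
  case True
  then show thesis using assms that[of "cmod b" 0] by simp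
next
  case False
  have "1 \<le> cmod (a * z + b)" if "(1 + cmod b) / cmod a \<le> cmod z" for z
  proof -
    have "1 + cmod b \<le> cmod (a * z)" using that False by (simp add: norm_mult field_simps)
    then show ?thesis using norm_diff_ineq[of "a * z" b] by simp
  qed
  then show thesis using that[of 1 "(1 + cmod b) / cmod a"] by simp
qed

text \<open>Outside a disc the separation estimate can be divided by \<open>d\<^sup>2\<close>. Since
  \<open>R\<close> and \<open>K\<close> do not depend on \<open>E\<close>, the estimate serves both
  for boundedness with a uniform \<open>E\<close> and for compactness with \<open>E\<close> tending
  to 0.\<close>

lemma symbol_weight_le_gap_outside:
  assumes affine: "\<And>z. \<phi>1 z = a1 * z + b1" "\<And>z. \<phi>2 z = a2 * z + b2" and ne: "\<phi>1 \<noteq> \<phi>2"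
  obtains R K :: real where "0 < K"
    "\<And>z E. R \<le> cmod z \<Longrightarrow> kernel_gap \<psi>1 \<phi>1 \<psi>2 \<phi>2 (\<phi>1 z) z \<le> E \<Longrightarrow>
       kernel_gap \<psi>1 \<phi>1 \<psi>2 \<phi>2 (\<phi>2 z) z \<le> E \<Longrightarrow> symbol_weight \<psi>1 \<phi>1 z \<le> K * E"
proof -
  have diff: "\<phi>1 z - \<phi>2 z = (a1 - a2) * z + (b1 - b2)" for z by (simp add: affine algebra_simps)
  have "a1 - a2 \<noteq> 0 \<or> b1 - b2 \<noteq> 0" using ne by (auto simp: affine fun_eq_iff)
  then obtain R \<delta> where R: "0 < \<delta>" "\<And>z. R \<le> cmod z \<Longrightarrow> \<delta> \<le> cmod (\<phi>1 z - \<phi>2 z)"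
    unfolding diff using affine_bounded_away by metis
  have "symbol_weight \<psi>1 \<phi>1 z \<le> 2 * (1 / \<delta>\<^sup>2 + 1) * E"
    if z: "R \<le> cmod z" and E: "kernel_gap \<psi>1 \<phi>1 \<psi>2 \<phi>2 (\<phi>1 z) z \<le> E"
      "kernel_gap \<psi>1 \<phi>1 \<psi>2 \<phi>2 (\<phi>2 z) z \<le> E" for z E
  proof -
    define d where "d = cmod (\<phi>1 z - \<phi>2 z)"
    have d: "\<delta> \<le> d" "0 < d" using R(1) R(2)[OF z] by (auto simp: d_def)
    have E0: "0 \<le> E" using E(1) by (rule order_trans[rotated]) (simp add: kernel_gap_def)
    have "symbol_weight \<psi>1 \<phi>1 z * d\<^sup>2 \<le> 2 * E * (1 + d\<^sup>2)"
      unfolding d_def by (rule symbol_weight_separation[OF E])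
    then have "symbol_weight \<psi>1 \<phi>1 z \<le> 2 * E * (1 + d\<^sup>2) / d\<^sup>2" using d by (simp add: pos_le_divide_eq)
    also have "\<dots> = 2 * E * (1 / d\<^sup>2 + 1)" using d by (simp add: field_simps)
    also have "\<dots> \<le> 2 * E * (1 / \<delta>\<^sup>2 + 1)"
      using d R(1) E0 by (intro mult_left_mono add_mono divide_left_mono power_mono) auto
    finally show ?thesis by (simp add: mult_ac)
  qed
  moreover have "0 < 2 * (1 / \<delta>\<^sup>2 + 1)" by (simp add: add_nonneg_pos)
  ultimately show thesis using that by blast
qed

lemma symbol_weight_continuous:
  assumes "\<psi> holomorphic_on UNIV" "\<phi> holomorphic_on UNIV"
  shows "continuous_on S (symbol_weight \<psi> \<phi>)"
proof -
  have "continuous_on S \<psi>" "continuous_on S \<phi>"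
    using assms by (auto intro: holomorphic_on_imp_continuous_on continuous_on_subset)
  then show ?thesis unfolding symbol_weight_def by (intro continuous_intros) auto
qed

lemma symbol_weight_bounded:
  assumes psi: "\<psi>1 holomorphic_on UNIV" and phi: "\<phi>1 holomorphic_on UNIV"
    and affine: "\<And>z. \<phi>1 z = a1 * z + b1" "\<And>z. \<phi>2 z = a2 * z + b2" and ne: "\<phi>1 \<noteq> \<phi>2"
    and E: "\<And>w z. kernel_gap \<psi>1 \<phi>1 \<psi>2 \<phi>2 w z \<le> E"
  obtains M where "\<And>z. symbol_weight \<psi>1 \<phi>1 z \<le> M"
proof -
  obtain R K where RK: "\<And>z. R \<le> cmod z \<Longrightarrow> symbol_weight \<psi>1 \<phi>1 z \<le> K * E"
    using symbol_weight_le_gap_outside[OF affine ne] E by metis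
  have "compact (symbol_weight \<psi>1 \<phi>1 ` cball 0 R)"
    using symbol_weight_continuous[OF psi phi] by (intro compact_continuous_image) auto
  then obtain B where "\<And>z. z \<in> cball 0 R \<Longrightarrow> symbol_weight \<psi>1 \<phi>1 z \<le> B"
    by (meson bounded_imp_bdd_above compact_imp_bounded bdd_above.unfold imageI)
  then have "symbol_weight \<psi>1 \<phi>1 z \<le> max B (K * E)" for z
    using RK[of z] by (cases "R \<le> cmod z") (auto simp: le_max_iff_disj)
  then show thesis by (rule that)
qed

section \<open>Boundedness and compactness in terms of integrals\<close>

text \<open>Makes it enough to extract subsequences from the set itself: a sequence in the closure
  is shadowed by one in \<open>S\<close> with errors tending to 0, and inherits its limit.\<close>

lemma (in Metric_space) compactin_closure_of_sequentially:
  assumes S: "S \<subseteq> M"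
  shows "compactin mtopology (mtopology closure_of S) \<longleftrightarrow>
    (\<forall>\<sigma>::nat \<Rightarrow> 'a. range \<sigma> \<subseteq> S \<longrightarrow>
       (\<exists>l r. l \<in> M \<and> strict_mono r \<and> limitin mtopology (\<sigma> \<circ> r) l sequentially))"
proof (intro iffI allI impI)
  fix \<sigma> :: "nat \<Rightarrow> 'a"
  assume "compactin mtopology (mtopology closure_of S)" and \<sigma>: "range \<sigma> \<subseteq> S"
  moreover have "S \<subseteq> mtopology closure_of S"
    using S by (intro closure_of_subset) simp
  ultimately have "\<exists>l r. l \<in> mtopology closure_of S \<and> strict_mono r \<and> limitin mtopology (\<sigma> \<circ> r) l sequentially"
    unfolding compactin_sequentially by (meson order_trans)
  then show "\<exists>l r. l \<in> M \<and> strict_mono r \<and> limitin mtopology (\<sigma> \<circ> r) l sequentially"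
    by (meson limitin_mspace)
next
  assume seq: "\<forall>\<sigma>::nat \<Rightarrow> 'a. range \<sigma> \<subseteq> S \<longrightarrow>
       (\<exists>l r. l \<in> M \<and> strict_mono r \<and> limitin mtopology (\<sigma> \<circ> r) l sequentially)"
  have "\<exists>l r. l \<in> mtopology closure_of S \<and> strict_mono r \<and> limitin mtopology (\<tau> \<circ> r) l sequentially"
    if \<tau>: "range \<tau> \<subseteq> mtopology closure_of S" for \<tau> :: "nat \<Rightarrow> 'a"
  proof -
    have \<tau>M: "\<tau> n \<in> M" for n using \<tau> by (auto simp: metric_closure_of)
    have "\<exists>y. y \<in> S \<and> d (\<tau> n) y < inverse (Suc n)" for n
    proof -
      have "\<tau> n \<in> mtopology closure_of S" using \<tau> by auto
      moreover have "0 < inverse (real (Suc n))" by simp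
      ultimately have "\<exists>y\<in>S. y \<in> mball (\<tau> n) (inverse (real (Suc n)))"
        unfolding metric_closure_of by blast
      then show ?thesis by auto
    qed
    then obtain \<sigma> where \<sigma>: "\<And>n. \<sigma> n \<in> S" "\<And>n. d (\<tau> n) (\<sigma> n) < inverse (Suc n)" by metis
    then obtain l r where l: "l \<in> M" "strict_mono r" "limitin mtopology (\<sigma> \<circ> r) l sequentially"
      using seq[rule_format, of \<sigma>] by auto
    have "limitin mtopology (\<tau> \<circ> r) l sequentially"
      unfolding limitin_metric
    proof (intro conjI allI impI)
      fix \<epsilon> :: real assume "0 < \<epsilon>"
      then have "0 < \<epsilon> / 2" by simp
      with l(3) have "\<forall>\<^sub>F n in sequentially. (\<sigma> \<circ> r) n \<in> M \<and> d ((\<sigma> \<circ> r) n) l < \<epsilon> / 2"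
        unfolding limitin_metric by blast
      moreover have "\<forall>\<^sub>F n in sequentially. inverse (real (Suc n)) < \<epsilon> / 2"
        using LIMSEQ_inverse_real_of_nat \<open>0 < \<epsilon>\<close> by (intro order_tendstoD(2)) auto
      ultimately show "\<forall>\<^sub>F n in sequentially. (\<tau> \<circ> r) n \<in> M \<and> d ((\<tau> \<circ> r) n) l < \<epsilon>"
      proof eventually_elim
        case (elim n)
        have "inverse (real (Suc (r n))) \<le> inverse (real (Suc n))"
          using seq_suble[OF l(2), of n] by (intro le_imp_inverse_le) auto
        then have "d (\<tau> (r n)) (\<sigma> (r n)) < \<epsilon> / 2" using \<sigma>(2)[of "r n"] elim by linarith
        moreover have "d (\<tau> (r n)) l \<le> d (\<tau> (r n)) (\<sigma> (r n)) + d (\<sigma> (r n)) l"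
          using \<tau>M \<sigma>(1)[of "r n"] S l(1) by (intro triangle) auto
        ultimately show ?case using elim \<tau>M by simp
      qed
    qed (rule l)
    moreover have "l \<in> mtopology closure_of S"
      using calculation \<tau>
      by (intro limitin_closedin[OF _ closedin_closure_of]) (auto intro!: always_eventually)
    ultimately show ?thesis using l by blast
  qed
  then show "compactin mtopology (mtopology closure_of S)"
    unfolding compactin_sequentially using closure_of_subset_topspace[of mtopology S] by simp
qed

text \<open>The case distinction mirrors the metric: for \<open>q \<ge> 1\<close> it is the norm,
  whose power \<open>q\<close> is the mass up to a constant; for \<open>q < 1\<close> it already is
  that power.\<close>

lemma fock_dist_le_iff_mass:
  assumes q: "0 < q" and f: "f \<in> fock_space q" and g: "g \<in> fock_space q" and r: "0 \<le> r"
  shows "fock_dist q f g \<le> r \<longleftrightarrow>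
    fock_mass q (\<lambda>z. f z - g z) \<le> ennreal (2 * pi / q * (if 1 \<le> q then r powr q else r))"
proof -
  define N where "N = fock_norm q (\<lambda>z. f z - g z)"
  have N: "0 \<le> N" by (simp add: N_def fock_norm_def)
  have mono: "N \<le> r \<longleftrightarrow> N powr q \<le> r powr q"
    using q r N powr_mono2[of q N r] powr_less_mono2[of q r N]
    by (cases "N \<le> r") (simp_all add: not_le)
  have "fock_dist q f g \<le> r \<longleftrightarrow> N powr q \<le> (if 1 \<le> q then r powr q else r)"
    using mono by (simp add: fock_dist_def N_def)
  also have "\<dots> \<longleftrightarrow> 2 * pi / q * N powr q \<le> 2 * pi / q * (if 1 \<le> q then r powr q else r)"
    using q by (intro mult_le_cancel_left_pos[symmetric]) simp
  also have "\<dots> \<longleftrightarrow> ennreal (2 * pi / q * N powr q) \<le> ennreal (2 * pi / q * (if 1 \<le> q then r powr q else r))"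
    using q r by (subst ennreal_le_iff) auto
  also have "ennreal (2 * pi / q * N powr q) = fock_mass q (\<lambda>z. f z - g z)"
    unfolding N_def by (rule fock_mass_eq_norm[OF q fock_space_diff[OF q f g], symmetric])
  finally show ?thesis .
qed

lemma fock_mass_finite_bound:
  assumes "f \<in> fock_space q"
  obtains B where "0 \<le> B" "fock_mass q f = ennreal B"
  using assms by (cases "fock_mass q f") (auto simp: fock_space_iff_mass)

lemma zero_in_fock_space: "0 < q \<Longrightarrow> (\<lambda>z. 0) \<in> fock_space q"
  by (simp add: fock_space_def fock_weighted_def)

lemma fock_bounded_iff_mass:
  assumes q: "0 < q"
  shows "fock_bounded p q T \<longleftrightarrow> (\<forall>f\<in>fock_space p. T f \<in> fock_space q) \<and>
    (\<exists>B::real. 0 \<le> B \<and> (\<forall>f\<in>fock_unit_ball p. fock_mass q (T f) \<le> ennreal B))"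
proof -
  interpret F: Metric_space "fock_space q" "fock_dist q" by (rule Metric_space_fock[OF q])
  note z = zero_in_fock_space[OF q]
  have "F.mbounded (T ` fock_unit_ball p) \<longleftrightarrow> (\<exists>B::real. 0 \<le> B \<and> (\<forall>f\<in>fock_unit_ball p. fock_mass q (T f) \<le> ennreal B))"
    if T: "\<forall>f\<in>fock_space p. T f \<in> fock_space q"
  proof -
    have Tb: "T f \<in> fock_space q" if "f \<in> fock_unit_ball p" for f
      using T that by (simp add: fock_unit_ball_def)
    show ?thesis
    proof
      assume "F.mbounded (T ` fock_unit_ball p)"
      \<comment> \<open>Metric boundedness only bounds mutual distances; adding the zero function
        turns this into a bound on distances from the origin.\<close>
      then have "F.mbounded (insert (\<lambda>z. 0) (T ` fock_unit_ball p))"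
        using z by (simp only: F.mbounded_insert)
      then obtain r where r: "\<forall>f\<in>fock_unit_ball p. fock_dist q (T f) (\<lambda>z. 0) \<le> r"
        unfolding F.mbounded_alt by auto
      then have "\<forall>f\<in>fock_unit_ball p. fock_dist q (T f) (\<lambda>z. 0) \<le> max r 0" by (auto simp: le_max_iff_disj)
      then have "\<forall>f\<in>fock_unit_ball p. fock_mass q (T f) \<le>
          ennreal (2 * pi / q * (if 1 \<le> q then max r 0 powr q else max r 0))"
        using fock_dist_le_iff_mass[OF q Tb z, of _ "max r 0"] by simp
      moreover have "0 \<le> 2 * pi / q * (if 1 \<le> q then max r 0 powr q else max r 0)" using q by simp
      ultimately show "\<exists>B::real. 0 \<le> B \<and> (\<forall>f\<in>fock_unit_ball p. fock_mass q (T f) \<le> ennreal B)" by blast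
    next
      assume "\<exists>B::real. 0 \<le> B \<and> (\<forall>f\<in>fock_unit_ball p. fock_mass q (T f) \<le> ennreal B)"
      then obtain B :: real where B: "0 \<le> B" "\<And>f. f \<in> fock_unit_ball p \<Longrightarrow> fock_mass q (T f) \<le> ennreal B" by auto
      define c where "c = B * q / (2 * pi)"
      define r where "r = (if 1 \<le> q then c powr (1 / q) else c)"
      have c: "0 \<le> c" "2 * pi / q * c = B" using B(1) q by (simp_all add: c_def)
      have r: "0 \<le> r" "(if 1 \<le> q then r powr q else r) = c"
        using c q by (auto simp: r_def powr_powr)
      have "fock_dist q (\<lambda>z. 0) (T f) \<le> r" if f: "f \<in> fock_unit_ball p" for f
        using B(2)[OF f] unfolding F.commute[of "\<lambda>z. 0"] fock_dist_le_iff_mass[OF q Tb[OF f] z r(1)]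
        by (simp only: r(2) c(2) diff_zero)
      then show "F.mbounded (T ` fock_unit_ball p)"
        unfolding F.mbounded using z Tb by blast
    qed
  qed
  then show ?thesis unfolding fock_bounded_def by blast
qed

lemma ennreal_tendsto_0_iff_le:
  fixes u :: "'a \<Rightarrow> ennreal"
  shows "(u \<longlongrightarrow> 0) F \<longleftrightarrow> (\<forall>e>0. \<forall>\<^sub>F x in F. u x \<le> ennreal e)"
proof
  assume u: "(u \<longlongrightarrow> 0) F"
  show "\<forall>e>0. \<forall>\<^sub>F x in F. u x \<le> ennreal e"
  proof (intro allI impI)
    fix e :: real assume "0 < e"
    then have "\<forall>\<^sub>F x in F. u x < ennreal e" using u by (intro order_tendstoD) auto
    then show "\<forall>\<^sub>F x in F. u x \<le> ennreal e" by eventually_elim simp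
  qed
next
  assume le: "\<forall>e>0. \<forall>\<^sub>F x in F. u x \<le> ennreal e"
  show "(u \<longlongrightarrow> 0) F"
  proof (rule order_tendstoI)
    fix a :: ennreal assume "0 < a"
    then obtain b where b: "0 < b" "b < a" using dense by blast
    then obtain e where e: "0 \<le> e" "b = ennreal e" by (cases b) auto
    then have "0 < e" using b by simp
    then have "\<forall>\<^sub>F x in F. u x \<le> ennreal e" using le by blast
    then show "\<forall>\<^sub>F x in F. u x < a" by eventually_elim (use b e in auto)
  qed simp
qed

lemma limitin_fock_iff_mass:
  assumes q: "0 < q" and \<sigma>: "\<And>n. \<sigma> n \<in> fock_space q" and l: "l \<in> fock_space q"
  shows "limitin (Metric_space.mtopology (fock_space q) (fock_dist q)) \<sigma> l sequentially \<longleftrightarrow>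
    (\<lambda>n. fock_mass q (\<lambda>z. \<sigma> n z - l z)) \<longlonglongrightarrow> 0"
proof -
  interpret F: Metric_space "fock_space q" "fock_dist q" by (rule Metric_space_fock[OF q])
  define \<rho> where "\<rho> r = 2 * pi / q * (if 1 \<le> q then r powr q else r)" for r :: real
  have le: "fock_dist q (\<sigma> n) l \<le> r \<longleftrightarrow> fock_mass q (\<lambda>z. \<sigma> n z - l z) \<le> ennreal (\<rho> r)" if "0 \<le> r" for r n
    unfolding \<rho>_def by (rule fock_dist_le_iff_mass[OF q \<sigma> l that])
  \<comment> \<open>Every positive tolerance for the mass comes from a radius, so the two families
    of tolerances define the same convergence.\<close>
  have \<rho>_surj: "\<exists>r>0. \<rho> r = e" if e: "0 < e" for e
  proof -
    define c where "c = e * q / (2 * pi)"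
    define r where "r = (if 1 \<le> q then c powr (1 / q) else c)"
    have c: "0 < c" "2 * pi / q * c = e" using e q by (simp_all add: c_def)
    have "0 < r" "(if 1 \<le> q then r powr q else r) = c" using c q by (auto simp: r_def powr_powr)
    then show ?thesis using c(2) by (auto simp: \<rho>_def)
  qed
  have \<rho>_pos: "0 < \<rho> r" if "0 < r" for r using that q by (simp add: \<rho>_def)
  have "limitin F.mtopology \<sigma> l sequentially \<longleftrightarrow>
      (\<forall>r>0. \<forall>\<^sub>F n in sequentially. fock_dist q (\<sigma> n) l < r)"
    unfolding F.limitin_metric using l \<sigma> by simp
  also have "\<dots> \<longleftrightarrow> (\<forall>r>0. \<forall>\<^sub>F n in sequentially. fock_dist q (\<sigma> n) l \<le> r)"
  proof (intro iffI allI impI)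
    fix r :: real assume "\<forall>r>0. \<forall>\<^sub>F n in sequentially. fock_dist q (\<sigma> n) l < r" "0 < r"
    then have "\<forall>\<^sub>F n in sequentially. fock_dist q (\<sigma> n) l < r" by blast
    then show "\<forall>\<^sub>F n in sequentially. fock_dist q (\<sigma> n) l \<le> r" by eventually_elim simp
  next
    fix r :: real assume "\<forall>r>0. \<forall>\<^sub>F n in sequentially. fock_dist q (\<sigma> n) l \<le> r" and r: "0 < r"
    then have "\<forall>\<^sub>F n in sequentially. fock_dist q (\<sigma> n) l \<le> r / 2" using half_gt_zero by blast
    then show "\<forall>\<^sub>F n in sequentially. fock_dist q (\<sigma> n) l < r" by eventually_elim (use r in simp)
  qed
  also have "\<dots> \<longleftrightarrow> (\<forall>e>0. \<forall>\<^sub>F n in sequentially. fock_mass q (\<lambda>z. \<sigma> n z - l z) \<le> ennreal e)"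
  proof (intro iffI allI impI)
    fix e :: real assume *: "\<forall>r>0. \<forall>\<^sub>F n in sequentially. fock_dist q (\<sigma> n) l \<le> r" and "0 < e"
    then obtain r where "0 < r" "\<rho> r = e" using \<rho>_surj by blast
    moreover from this have "\<forall>\<^sub>F n in sequentially. fock_dist q (\<sigma> n) l \<le> r" using * by blast
    ultimately show "\<forall>\<^sub>F n in sequentially. fock_mass q (\<lambda>z. \<sigma> n z - l z) \<le> ennreal e"
      using le[of r] by (auto elim!: eventually_mono)
  next
    fix r :: real
    assume *: "\<forall>e>0. \<forall>\<^sub>F n in sequentially. fock_mass q (\<lambda>z. \<sigma> n z - l z) \<le> ennreal e" and "0 < r"
    then show "\<forall>\<^sub>F n in sequentially. fock_dist q (\<sigma> n) l \<le> r"
      using le[of r] \<rho>_pos[of r] by simp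
  qed
  also have "\<dots> \<longleftrightarrow> (\<lambda>n. fock_mass q (\<lambda>z. \<sigma> n z - l z)) \<longlonglongrightarrow> 0"
    by (rule ennreal_tendsto_0_iff_le[symmetric])
  finally show ?thesis .
qed

lemma fock_compact_iff_mass:
  assumes q: "0 < q"
  shows "fock_compact p q T \<longleftrightarrow> (\<forall>f\<in>fock_space p. T f \<in> fock_space q) \<and>
    (\<forall>\<sigma>. (\<forall>n::nat. \<sigma> n \<in> fock_unit_ball p) \<longrightarrow>
      (\<exists>l r. l \<in> fock_space q \<and> strict_mono r \<and> (\<lambda>n. fock_mass q (\<lambda>z. T (\<sigma> (r n)) z - l z)) \<longlonglongrightarrow> 0))"
proof -
  interpret F: Metric_space "fock_space q" "fock_dist q" by (rule Metric_space_fock[OF q])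
  have "compactin F.mtopology (F.mtopology closure_of (T ` fock_unit_ball p)) \<longleftrightarrow>
    (\<forall>\<sigma>. (\<forall>n::nat. \<sigma> n \<in> fock_unit_ball p) \<longrightarrow>
      (\<exists>l r. l \<in> fock_space q \<and> strict_mono r \<and> (\<lambda>n. fock_mass q (\<lambda>z. T (\<sigma> (r n)) z - l z)) \<longlonglongrightarrow> 0))"
    if T: "\<forall>f\<in>fock_space p. T f \<in> fock_space q"
  proof -
    have Tb: "T f \<in> fock_space q" if "f \<in> fock_unit_ball p" for f
      using T that by (simp add: fock_unit_ball_def)
    have lim: "limitin F.mtopology ((T \<circ> \<sigma>) \<circ> r) l sequentially \<longleftrightarrow>
        (\<lambda>n. fock_mass q (\<lambda>z. T (\<sigma> (r n)) z - l z)) \<longlonglongrightarrow> 0"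
      if "\<forall>n. \<sigma> n \<in> fock_unit_ball p" "l \<in> fock_space q" for \<sigma> :: "nat \<Rightarrow> complex \<Rightarrow> complex" and r :: "nat \<Rightarrow> nat" and l
      using limitin_fock_iff_mass[OF q _ that(2), of "(T \<circ> \<sigma>) \<circ> r"] Tb that(1) by simp
    have range_iff: "(\<forall>\<tau>::nat \<Rightarrow> complex \<Rightarrow> complex. range \<tau> \<subseteq> T ` fock_unit_ball p \<longrightarrow> P \<tau>) \<longleftrightarrow>
        (\<forall>\<sigma>. (\<forall>n. \<sigma> n \<in> fock_unit_ball p) \<longrightarrow> P (T \<circ> \<sigma>))" for P
    proof (intro iffI allI impI)
      fix \<tau> :: "nat \<Rightarrow> complex \<Rightarrow> complex"
      assume P: "\<forall>\<sigma>. (\<forall>n. \<sigma> n \<in> fock_unit_ball p) \<longrightarrow> P (T \<circ> \<sigma>)" and "range \<tau> \<subseteq> T ` fock_unit_ball p"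
      then have "\<forall>n. \<exists>f\<in>fock_unit_ball p. \<tau> n = T f" by blast
      then obtain \<sigma> where "\<forall>n. \<sigma> n \<in> fock_unit_ball p \<and> \<tau> n = T (\<sigma> n)" by metis
      then have "\<tau> = T \<circ> \<sigma>" "\<forall>n. \<sigma> n \<in> fock_unit_ball p" by auto
      then show "P \<tau>" using P by blast
    next
      fix \<sigma> :: "nat \<Rightarrow> complex \<Rightarrow> complex"
      assume P: "\<forall>\<tau>::nat \<Rightarrow> complex \<Rightarrow> complex. range \<tau> \<subseteq> T ` fock_unit_ball p \<longrightarrow> P \<tau>"
        and "\<forall>n. \<sigma> n \<in> fock_unit_ball p"
      then have "range (T \<circ> \<sigma>) \<subseteq> T ` fock_unit_ball p" by auto
      then show "P (T \<circ> \<sigma>)" using P by blast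
    qed
    have sub: "T ` fock_unit_ball p \<subseteq> fock_space q" using Tb by blast
    show ?thesis
      unfolding F.compactin_closure_of_sequentially[OF sub] range_iff using lim by meson
  qed
  then show ?thesis unfolding fock_compact_def Let_def by blast
qed

section \<open>Differences of bounded and of compact operators\<close>

lemma ennreal_tendsto_0_mono:
  fixes u v :: "'a \<Rightarrow> ennreal"
  assumes "\<And>x. u x \<le> v x" "(v \<longlongrightarrow> 0) F"
  shows "(u \<longlongrightarrow> 0) F"
  by (rule tendsto_sandwich[of "\<lambda>_. 0" u F v]) (use assms in auto)

lemma fock_mass_minus_commute: "fock_mass q (\<lambda>z. f z - g z) = fock_mass q (\<lambda>z. g z - f z)"
  by (simp add: fock_mass_def fock_weighted_def norm_minus_commute)

text \<open>Rests on \<open>powr_add_le_2\<close>, valid for all positive exponents. The constant is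
  harmless because only boundedness and convergence to 0 are tracked.\<close>

lemma fock_mass_diff_le:
  assumes q: "0 < q" and f: "f holomorphic_on UNIV" and g: "g holomorphic_on UNIV"
  shows "fock_mass q (\<lambda>z. f z - g z) \<le> ennreal (2 powr q) * (fock_mass q f + fock_mass q g)"
proof -
  note [measurable] = fock_weighted_measurable[OF f] fock_weighted_measurable[OF g]
  have "fock_mass q (\<lambda>z. f z - g z) \<le>
      (\<integral>\<^sup>+z. ennreal (2 powr q) * (ennreal (fock_weighted q f z) + ennreal (fock_weighted q g z)) \<partial>lborel)"
    unfolding fock_mass_def
  proof (rule nn_integral_mono)
    fix z
    have "cmod (f z - g z) powr q \<le> (cmod (f z) + cmod (g z)) powr q"
      using q by (intro powr_mono2 norm_triangle_ineq4) auto
    also have "\<dots> \<le> 2 powr q * (cmod (f z) powr q + cmod (g z) powr q)"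
      using q by (intro powr_add_le_2) auto
    finally have "cmod (f z - g z) powr q * exp (- (q * (cmod z)\<^sup>2 / 2))
        \<le> 2 powr q * (cmod (f z) powr q + cmod (g z) powr q) * exp (- (q * (cmod z)\<^sup>2 / 2))"
      by (intro mult_right_mono) auto
    also have "\<dots> = 2 powr q * (fock_weighted q f z + fock_weighted q g z)"
      by (simp add: fock_weighted_def algebra_simps)
    finally have "ennreal (fock_weighted q (\<lambda>z. f z - g z) z) \<le>
        ennreal (2 powr q * (fock_weighted q f z + fock_weighted q g z))"
      by (intro ennreal_leI) (simp add: fock_weighted_def)
    then show "ennreal (fock_weighted q (\<lambda>z. f z - g z) z) \<le>
        ennreal (2 powr q) * (ennreal (fock_weighted q f z) + ennreal (fock_weighted q g z))"
      by (simp add: ennreal_mult ennreal_plus fock_weighted_nonneg)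
  qed
  also have "\<dots> = ennreal (2 powr q) * (\<integral>\<^sup>+z. (ennreal (fock_weighted q f z) + ennreal (fock_weighted q g z)) \<partial>lborel)"
    by (rule nn_integral_cmult) measurable
  also have "(\<integral>\<^sup>+z. (ennreal (fock_weighted q f z) + ennreal (fock_weighted q g z)) \<partial>lborel) = fock_mass q f + fock_mass q g"
    unfolding fock_mass_def by (rule nn_integral_add) measurable
  finally show ?thesis .
qed

lemma fock_mass_cmult:
  assumes f: "f holomorphic_on UNIV"
  shows "fock_mass q (\<lambda>z. c * f z) = ennreal (cmod c powr q) * fock_mass q f"
proof -
  note [measurable] = fock_weighted_measurable[OF f]
  have "ennreal (fock_weighted q (\<lambda>z. c * f z) z) = ennreal (cmod c powr q) * ennreal (fock_weighted q f z)" for z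
    by (simp add: fock_weighted_def norm_mult powr_mult mult.assoc flip: ennreal_mult)
  then show ?thesis
    unfolding fock_mass_def by (simp only:) (rule nn_integral_cmult, measurable)
qed

lemma fock_space_cmult:
  assumes f: "f \<in> fock_space q"
  shows "(\<lambda>z. c * f z) \<in> fock_space q"
proof -
  have "(\<lambda>z. c * f z) holomorphic_on UNIV"
    using f by (auto simp: fock_space_def intro!: holomorphic_intros)
  then show ?thesis
    using f by (auto simp: fock_space_iff_mass fock_mass_cmult ennreal_mult_less_top)
qed

lemma fock_space_minus_commute:
  assumes "(\<lambda>z. f z - g z) \<in> fock_space q"
  shows "(\<lambda>z. g z - f z) \<in> fock_space q"
  using fock_space_cmult[OF assms, of "-1"] by simp

lemma fock_compact_subsequence:
  fixes \<sigma> :: "nat \<Rightarrow> complex \<Rightarrow> complex"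
  assumes q: "0 < q" and T: "fock_compact p q T" and \<sigma>: "\<And>n. \<sigma> n \<in> fock_unit_ball p"
  obtains l r where "l \<in> fock_space q" "strict_mono r"
    "(\<lambda>n. fock_mass q (\<lambda>z. T (\<sigma> (r n)) z - l z)) \<longlonglongrightarrow> 0"
proof -
  have "\<exists>l r. l \<in> fock_space q \<and> strict_mono r \<and> (\<lambda>n. fock_mass q (\<lambda>z. T (\<sigma> (r n)) z - l z)) \<longlonglongrightarrow> 0"
    using T \<sigma> by (auto simp: fock_compact_iff_mass[OF q] dest!: conjunct2 spec[of _ \<sigma>])
  then show thesis using that by blast
qed

lemma fock_compact_maps:
  "0 < q \<Longrightarrow> fock_compact p q T \<Longrightarrow> f \<in> fock_space p \<Longrightarrow> T f \<in> fock_space q"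
  by (auto simp: fock_compact_def)

lemma fock_bounded_minus_commute:
  assumes q: "0 < q" and AB: "fock_bounded p q (A - B)"
  shows "fock_bounded p q (B - A)"
proof -
  obtain b where b: "0 \<le> b" "\<And>f. f \<in> fock_unit_ball p \<Longrightarrow> fock_mass q (\<lambda>z. A f z - B f z) \<le> ennreal b"
    using AB unfolding fock_bounded_iff_mass[OF q] fun_diff_def by blast
  have "(\<lambda>z. A f z - B f z) \<in> fock_space q" if "f \<in> fock_space p" for f
    using AB that unfolding fock_bounded_iff_mass[OF q] fun_diff_def by blast
  then have "(\<lambda>z. B f z - A f z) \<in> fock_space q" if "f \<in> fock_space p" for f
    using that fock_space_minus_commute[of "A f" "B f"] by simp
  moreover have "fock_mass q (\<lambda>z. B f z - A f z) \<le> ennreal b" if "f \<in> fock_unit_ball p" for f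
    using b(2)[OF that] by (subst fock_mass_minus_commute)
  ultimately show ?thesis
    unfolding fock_bounded_iff_mass[OF q] fun_diff_def using b(1) by blast
qed

lemma fock_compact_minus_commute:
  assumes q: "0 < q" and AB: "fock_compact p q (A - B)"
  shows "fock_compact p q (B - A)"
  unfolding fock_compact_iff_mass[OF q] fun_diff_def
proof (intro conjI ballI allI impI)
  fix f assume "f \<in> fock_space p"
  then show "(\<lambda>z. B f z - A f z) \<in> fock_space q"
    using fock_compact_maps[OF q AB, of f] fock_space_minus_commute[of "A f" "B f"]
    by (simp add: fun_diff_def)
next
  fix \<sigma> :: "nat \<Rightarrow> complex \<Rightarrow> complex" assume "\<forall>n. \<sigma> n \<in> fock_unit_ball p"
  then obtain l r where l: "l \<in> fock_space q" "strict_mono r"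
      "(\<lambda>n. fock_mass q (\<lambda>z. A (\<sigma> (r n)) z - B (\<sigma> (r n)) z - l z)) \<longlonglongrightarrow> 0"
    using fock_compact_subsequence[OF q AB, of \<sigma>] unfolding fun_diff_def by blast
  have "fock_mass q (\<lambda>z. A (\<sigma> n) z - B (\<sigma> n) z - l z) = fock_mass q (\<lambda>z. B (\<sigma> n) z - A (\<sigma> n) z - (- l z))" for n
    by (subst fock_mass_minus_commute) (simp add: algebra_simps)
  moreover have "(\<lambda>z. - l z) \<in> fock_space q" using fock_space_cmult[OF l(1), of "-1"] by simp
  ultimately show "\<exists>l r. l \<in> fock_space q \<and> strict_mono r \<and>
      (\<lambda>n. fock_mass q (\<lambda>z. B (\<sigma> (r n)) z - A (\<sigma> (r n)) z - l z)) \<longlonglongrightarrow> 0"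
    using l by (intro exI[of _ "\<lambda>z. - l z"] exI[of _ r]) simp
qed

lemma fock_bounded_diff:
  assumes q: "0 < q" and A: "fock_bounded p q A" and B: "fock_bounded p q B"
  shows "fock_bounded p q (A - B)"
proof -
  obtain a where a: "0 \<le> a" "\<And>f. f \<in> fock_unit_ball p \<Longrightarrow> fock_mass q (A f) \<le> ennreal a"
    using A unfolding fock_bounded_iff_mass[OF q] by blast
  obtain b where b: "0 \<le> b" "\<And>f. f \<in> fock_unit_ball p \<Longrightarrow> fock_mass q (B f) \<le> ennreal b"
    using B unfolding fock_bounded_iff_mass[OF q] by blast
  have mem: "A f \<in> fock_space q" "B f \<in> fock_space q" if "f \<in> fock_space p" for f
    using A B that unfolding fock_bounded_iff_mass[OF q] by blast+
  have "fock_mass q (\<lambda>z. A f z - B f z) \<le> ennreal (2 powr q * (a + b))" if f: "f \<in> fock_unit_ball p" for f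
  proof -
    have "f \<in> fock_space p" using f by (simp add: fock_unit_ball_def)
    then have "fock_mass q (\<lambda>z. A f z - B f z) \<le> ennreal (2 powr q) * (fock_mass q (A f) + fock_mass q (B f))"
      using mem by (intro fock_mass_diff_le q) (auto simp: fock_space_def)
    also have "\<dots> \<le> ennreal (2 powr q) * (ennreal a + ennreal b)"
      using a b f by (intro mult_left_mono add_mono) auto
    finally show ?thesis using a(1) b(1) by (simp add: ennreal_mult ennreal_plus)
  qed
  moreover have "0 \<le> 2 powr q * (a + b)" using a(1) b(1) by simp
  ultimately show ?thesis
    unfolding fock_bounded_iff_mass[OF q] fun_diff_def using mem fock_space_diff[OF q] by blast
qed

lemma fock_compact_diff:
  assumes q: "0 < q" and A: "fock_compact p q A" and B: "fock_compact p q B"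
  shows "fock_compact p q (A - B)"
  unfolding fock_compact_iff_mass[OF q] fun_diff_def
proof (intro conjI ballI allI impI)
  have mem: "A f \<in> fock_space q" "B f \<in> fock_space q" if "f \<in> fock_space p" for f
    using A B that by (simp_all add: fock_compact_maps[OF q])
  show "(\<lambda>z. A f z - B f z) \<in> fock_space q" if "f \<in> fock_space p" for f
    using fock_space_diff[OF q mem[OF that]] .
  fix \<sigma> :: "nat \<Rightarrow> complex \<Rightarrow> complex" assume \<sigma>: "\<forall>n. \<sigma> n \<in> fock_unit_ball p"
  then obtain l r where l: "l \<in> fock_space q" "strict_mono r"
      "(\<lambda>n. fock_mass q (\<lambda>z. A (\<sigma> (r n)) z - l z)) \<longlonglongrightarrow> 0"
    using fock_compact_subsequence[OF q A, of \<sigma>] by blast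
  have "\<forall>n. (\<sigma> \<circ> r) n \<in> fock_unit_ball p" using \<sigma> by simp
  then obtain l' r' where l': "l' \<in> fock_space q" "strict_mono r'"
      "(\<lambda>n. fock_mass q (\<lambda>z. B ((\<sigma> \<circ> r) (r' n)) z - l' z)) \<longlonglongrightarrow> 0"
    using fock_compact_subsequence[OF q B, of "\<sigma> \<circ> r"] by blast
  \<comment> \<open>The second extraction is made inside the first, so both images converge along
    \<open>s\<close>.\<close>
  define s where "s n = r (r' n)" for n
  have s: "strict_mono s" using l(2) l'(2) by (simp add: s_def strict_mono_def)
  have mem': "A (\<sigma> n) \<in> fock_space q" "B (\<sigma> n) \<in> fock_space q" for n
    using mem \<sigma> by (auto simp: fock_unit_ball_def)
  have Al: "(\<lambda>n. fock_mass q (\<lambda>z. A (\<sigma> (s n)) z - l z)) \<longlonglongrightarrow> 0"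
    using LIMSEQ_subseq_LIMSEQ[OF l(3) l'(2)] by (simp add: s_def o_def)
  have Bl: "(\<lambda>n. fock_mass q (\<lambda>z. B (\<sigma> (s n)) z - l' z)) \<longlonglongrightarrow> 0"
    using l'(3) by (simp add: s_def)
  have le: "fock_mass q (\<lambda>z. A (\<sigma> n) z - B (\<sigma> n) z - (l z - l' z)) \<le> ennreal (2 powr q) *
      (fock_mass q (\<lambda>z. A (\<sigma> n) z - l z) + fock_mass q (\<lambda>z. B (\<sigma> n) z - l' z))" for n
  proof -
    have "fock_mass q (\<lambda>z. (A (\<sigma> n) z - l z) - (B (\<sigma> n) z - l' z)) \<le> ennreal (2 powr q) *
      (fock_mass q (\<lambda>z. A (\<sigma> n) z - l z) + fock_mass q (\<lambda>z. B (\<sigma> n) z - l' z))"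
      using fock_space_diff[OF q mem'(1) l(1)] fock_space_diff[OF q mem'(2) l'(1)]
      by (intro fock_mass_diff_le q) (auto simp: fock_space_def)
    then show ?thesis by (simp add: algebra_simps)
  qed
  have "(\<lambda>n. ennreal (2 powr q) * (fock_mass q (\<lambda>z. A (\<sigma> (s n)) z - l z) + fock_mass q (\<lambda>z. B (\<sigma> (s n)) z - l' z)))
      \<longlonglongrightarrow> ennreal (2 powr q) * (0 + 0)"
    by (intro ennreal_tendsto_cmult tendsto_add Al Bl) simp
  then have "(\<lambda>n. fock_mass q (\<lambda>z. A (\<sigma> (s n)) z - B (\<sigma> (s n)) z - (l z - l' z))) \<longlonglongrightarrow> 0"
    by (intro ennreal_tendsto_0_mono[OF le]) simp
  moreover have "(\<lambda>z. l z - l' z) \<in> fock_space q" by (rule fock_space_diff[OF q l(1) l'(1)])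
  ultimately show "\<exists>l r. l \<in> fock_space q \<and> strict_mono r \<and>
      (\<lambda>n. fock_mass q (\<lambda>z. A (\<sigma> (r n)) z - B (\<sigma> (r n)) z - l z)) \<longlonglongrightarrow> 0"
    using s by blast
qed

lemma fock_compact_imp_bounded:
  assumes q: "0 < q" and T: "fock_compact p q T"
  shows "fock_bounded p q T"
proof -
  interpret F: Metric_space "fock_space q" "fock_dist q" by (rule Metric_space_fock[OF q])
  have T': "T ` fock_space p \<subseteq> fock_space q"
    and "compactin F.mtopology (F.mtopology closure_of (T ` fock_unit_ball p))"
    using T by (simp_all add: fock_compact_def Let_def)
  then have "F.mbounded (F.mtopology closure_of (T ` fock_unit_ball p))"
    by (intro F.compactin_imp_mbounded)
  moreover have "T ` fock_unit_ball p \<subseteq> fock_space q"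
    using T' by (auto simp: fock_unit_ball_def)
  ultimately show ?thesis
    using T' by (simp add: fock_bounded_def F.mbounded_closure_of_eq)
qed

section \<open>Sufficient conditions for a single weighted composition operator\<close>

lemma weighted_comp_holomorphic:
  assumes "\<psi> holomorphic_on UNIV" "\<phi> holomorphic_on UNIV" "f holomorphic_on UNIV"
  shows "weighted_comp \<psi> \<phi> f holomorphic_on UNIV"
proof -
  have "f \<circ> \<phi> holomorphic_on UNIV"
    using assms by (intro holomorphic_on_compose_gen[of _ _ f UNIV]) auto
  then show ?thesis unfolding weighted_comp_def using assms by (intro holomorphic_on_mult)
qed

lemma fock_weighted_weighted_comp:
  "fock_weighted q (weighted_comp \<psi> \<phi> f) z = symbol_weight \<psi> \<phi> z powr q * fock_weighted q f (\<phi> z)"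
proof -
  have "exp (- ((cmod z)\<^sup>2 / 2)) =
      exp (((cmod (\<phi> z))\<^sup>2 - (cmod z)\<^sup>2) / 2) * exp (- ((cmod (\<phi> z))\<^sup>2 / 2))"
    by (simp add: diff_divide_distrib flip: exp_add)
  then show ?thesis
    by (simp add: fock_weighted_eq_powr weighted_comp_def symbol_weight_def norm_mult mult_ac flip: powr_mult)
qed

lemma fock_mass_pointwise_bound:
  fixes p B :: real
  assumes p: "0 < p"
  obtains C :: real where "0 \<le> C"
    "\<And>f z. f holomorphic_on UNIV \<Longrightarrow> fock_mass p f \<le> ennreal B \<Longrightarrow> cmod (f z) \<le> C * exp ((cmod z)\<^sup>2 / 2)"
proof -
  obtain c :: real where c: "0 < c"
    "\<And>f z. f holomorphic_on UNIV \<Longrightarrow> ennreal (fock_weighted p f z) \<le> c * fock_mass p f"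
    using fock_weighted_le_mass[OF p] by metis
  define b where "b = c * max 0 B"
  have b: "0 \<le> b" using c(1) by (simp add: b_def)
  have "cmod (f z) \<le> b powr (1 / p) * exp ((cmod z)\<^sup>2 / 2)"
    if f: "f holomorphic_on UNIV" and le: "fock_mass p f \<le> ennreal B" for f z
  proof -
    have "ennreal (fock_weighted p f z) \<le> c * fock_mass p f" using f by (rule c)
    also have "\<dots> \<le> ennreal c * ennreal (max 0 B)"
      using le by (intro mult_left_mono) (auto simp: max_def ennreal_neg)
    finally have "ennreal (fock_weighted p f z) \<le> ennreal b" using c(1) by (simp add: b_def ennreal_mult)
    then have "fock_weighted p f z \<le> b" using b by (subst (asm) ennreal_le_iff) auto
    then have "fock_weighted p f z powr (1 / p) \<le> b powr (1 / p)"
      using p fock_weighted_nonneg by (intro powr_mono2) auto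
    then have "cmod (f z) * exp (- ((cmod z)\<^sup>2 / 2)) \<le> b powr (1 / p)"
      using p by (simp add: fock_weighted_eq_powr powr_powr)
    then show ?thesis by (simp add: exp_minus field_simps)
  qed
  then show thesis using that[of "b powr (1 / p)"] by simp
qed

text \<open>The weight comes out of the integral as \<open>M powr q\<close>, the affine substitution
  (available because \<open>a \<noteq> 0\<close>) returns the mass of \<open>f\<close> for
  \<open>q\<close>, and the embedding controls that by the mass for \<open>p\<close>.\<close>

lemma fock_bounded_of_symbol_weight:
  assumes p: "0 < p" and q: "p \<le> q" and psi: "\<psi> holomorphic_on UNIV" and phi: "\<phi> holomorphic_on UNIV"
    and affine: "\<And>z. \<phi> z = a * z + b" and a: "a \<noteq> 0" and M: "\<And>z. symbol_weight \<psi> \<phi> z \<le> M"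
  shows "fock_bounded p q (weighted_comp \<psi> \<phi>)"
proof -
  have q0: "0 < q" using p q by simp
  obtain K :: real where K: "0 \<le> K" "\<And>f. f holomorphic_on UNIV \<Longrightarrow>
       (\<integral>\<^sup>+z. fock_weighted q f (a * z + b) \<partial>lborel) \<le> K * fock_mass q f"
    using nn_integral_fock_weighted_affine[OF q0 a] by metis
  have mass_le: "fock_mass q (weighted_comp \<psi> \<phi> f) \<le> ennreal (M powr q) * (K * fock_mass q f)"
    if f: "f holomorphic_on UNIV" for f
  proof -
    have [measurable]: "fock_weighted q f \<in> borel_measurable borel"
      using fock_weighted_measurable[OF f] by simp
    have "fock_mass q (weighted_comp \<psi> \<phi> f) \<le> (\<integral>\<^sup>+z. ennreal (M powr q) * fock_weighted q f (a * z + b) \<partial>lborel)"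
      unfolding fock_mass_def fock_weighted_weighted_comp affine[symmetric]
    proof (rule nn_integral_mono)
      fix z
      have "ennreal (symbol_weight \<psi> \<phi> z powr q * fock_weighted q f (\<phi> z)) \<le>
          ennreal (M powr q * fock_weighted q f (\<phi> z))"
        using M[of z] q0 symbol_weight_nonneg fock_weighted_nonneg
        by (intro ennreal_leI mult_right_mono powr_mono2) auto
      then show "ennreal (symbol_weight \<psi> \<phi> z powr q * fock_weighted q f (\<phi> z)) \<le>
          ennreal (M powr q) * fock_weighted q f (\<phi> z)"
        by (simp add: ennreal_mult fock_weighted_nonneg)
    qed
    also have "\<dots> = ennreal (M powr q) * (\<integral>\<^sup>+z. fock_weighted q f (a * z + b) \<partial>lborel)"
      by (rule nn_integral_cmult) measurable
    also have "\<dots> \<le> ennreal (M powr q) * (K * fock_mass q f)"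
      using K(2)[OF f] by (intro mult_left_mono) auto
    finally show ?thesis .
  qed
  obtain D :: real where D: "0 \<le> D"
    "\<And>f. f holomorphic_on UNIV \<Longrightarrow> fock_mass p f \<le> ennreal (2 * pi / p) \<Longrightarrow> fock_mass q f \<le> ennreal D"
    using fock_mass_mono_exponent[OF p q] by metis
  have "weighted_comp \<psi> \<phi> f \<in> fock_space q" if "f \<in> fock_space p" for f
  proof -
    have f: "f holomorphic_on UNIV" "fock_mass q f < \<infinity>"
      using fock_space_mono[OF p q] that by (auto simp: fock_space_iff_mass)
    have "fock_mass q (weighted_comp \<psi> \<phi> f) < \<infinity>"
      using f(2) by (intro order_le_less_trans[OF mass_le[OF f(1)]]) (simp add: ennreal_mult_less_top)
    then show ?thesis
      using weighted_comp_holomorphic[OF psi phi f(1)] by (simp add: fock_space_iff_mass)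
  qed
  moreover have "fock_mass q (weighted_comp \<psi> \<phi> f) \<le> ennreal (M powr q * (K * D))"
    if "f \<in> fock_unit_ball p" for f
  proof -
    have f: "f holomorphic_on UNIV" "fock_mass q f \<le> ennreal D"
      using that D(2) by (auto simp: fock_unit_ball_iff_mass[OF p])
    note mass_le[OF f(1)]
    also have "ennreal (M powr q) * (K * fock_mass q f) \<le> ennreal (M powr q) * (K * ennreal D)"
      using f(2) by (intro mult_left_mono) auto
    finally show ?thesis using K(1) D(1) by (simp add: ennreal_mult)
  qed
  moreover have "0 \<le> M powr q * (K * D)" using K(1) D(1) by simp
  ultimately show ?thesis unfolding fock_bounded_iff_mass[OF q0] by blast
qed

text \<open>The operator is \<open>f \<mapsto> f b * \<psi>\<close>, a bounded point evaluation
  times a fixed member of the target space.\<close>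

lemma fock_bounded_of_const:
  assumes p: "0 < p" and q: "0 < q" and psi: "\<psi> \<in> fock_space q" and const: "\<And>z. \<phi> z = b"
  shows "fock_bounded p q (weighted_comp \<psi> \<phi>)"
proof -
  have eq: "weighted_comp \<psi> \<phi> f = (\<lambda>z. f b * \<psi> z)" for f
    by (simp add: weighted_comp_def const mult.commute)
  obtain C :: real where C: "0 \<le> C" "\<And>f z. f holomorphic_on UNIV \<Longrightarrow>
      fock_mass p f \<le> ennreal (2 * pi / p) \<Longrightarrow> cmod (f z) \<le> C * exp ((cmod z)\<^sup>2 / 2)"
    using fock_mass_pointwise_bound[OF p] by metis
  define c where "c = C * exp ((cmod b)\<^sup>2 / 2)"
  obtain B where B: "0 \<le> B" "fock_mass q \<psi> = ennreal B"
    using fock_mass_finite_bound[OF psi] by metis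
  have hpsi: "\<psi> holomorphic_on UNIV" using psi by (simp add: fock_space_def)
  have "fock_mass q (weighted_comp \<psi> \<phi> f) \<le> ennreal (c powr q * B)" if "f \<in> fock_unit_ball p" for f
  proof -
    have "cmod (f b) \<le> c" using that C(2) by (auto simp: fock_unit_ball_iff_mass[OF p] c_def)
    then have "ennreal (cmod (f b) powr q) \<le> ennreal (c powr q)"
      using q by (intro ennreal_leI powr_mono2) auto
    then have "ennreal (cmod (f b) powr q) * ennreal B \<le> ennreal (c powr q) * ennreal B"
      by (rule mult_right_mono) simp
    then show ?thesis using B by (simp add: eq fock_mass_cmult[OF hpsi] ennreal_mult)
  qed
  moreover have "0 \<le> c powr q * B" using B(1) by simp
  ultimately show ?thesis
    unfolding fock_bounded_iff_mass[OF q] using fock_space_cmult[OF psi] by (auto simp: eq)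
qed

text \<open>Uniformly bounded point evaluations make the unit ball locally bounded, so Montel's
  theorem applies; Fatou's lemma keeps the limit in the ball. Only pointwise convergence is
  recorded, which is enough for dominated convergence.\<close>

lemma fock_unit_ball_normal_family:
  fixes \<sigma> :: "nat \<Rightarrow> complex \<Rightarrow> complex"
  assumes p: "0 < p" and \<sigma>: "\<And>n. \<sigma> n \<in> fock_unit_ball p"
  obtains g r where "g \<in> fock_unit_ball p" "strict_mono r" "\<And>z. (\<lambda>n. \<sigma> (r n) z) \<longlonglongrightarrow> g z"
proof -
  obtain C :: real where C: "0 \<le> C" "\<And>f z. f holomorphic_on UNIV \<Longrightarrow>
      fock_mass p f \<le> ennreal (2 * pi / p) \<Longrightarrow> cmod (f z) \<le> C * exp ((cmod z)\<^sup>2 / 2)"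
    using fock_mass_pointwise_bound[OF p] by metis
  have ball: "f holomorphic_on UNIV" "fock_mass p f \<le> ennreal (2 * pi / p)" if "f \<in> fock_unit_ball p" for f
    using that by (auto simp: fock_unit_ball_iff_mass[OF p])
  have bounded: "\<exists>B. \<forall>h\<in>fock_unit_ball p. \<forall>z\<in>K. cmod (h z) \<le> B" if "compact K" for K
  proof -
    obtain \<rho> where \<rho>: "\<And>z. z \<in> K \<Longrightarrow> cmod z \<le> \<rho>"
      using compact_imp_bounded[OF \<open>compact K\<close>] by (auto simp: bounded_iff)
    have "cmod (h z) \<le> C * exp (\<rho>\<^sup>2 / 2)" if "h \<in> fock_unit_ball p" "z \<in> K" for h z
    proof -
      have "(cmod z)\<^sup>2 \<le> \<rho>\<^sup>2" using \<rho>[OF that(2)] by (intro power_mono) auto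
      then have "C * exp ((cmod z)\<^sup>2 / 2) \<le> C * exp (\<rho>\<^sup>2 / 2)" using C(1) by (intro mult_left_mono) auto
      with C(2)[OF ball[OF that(1)], of z] show ?thesis by linarith
    qed
    then show ?thesis by blast
  qed
  have range: "range \<sigma> \<subseteq> fock_unit_ball p" using \<sigma> by auto
  obtain g r where g: "g holomorphic_on UNIV" and r: "strict_mono (r :: nat \<Rightarrow> nat)"
    and lim: "\<And>z. (\<lambda>n. \<sigma> (r n) z) \<longlonglongrightarrow> g z"
    by (rule Montel[OF open_UNIV ball(1) bounded range]) auto
  have lim_w: "(\<lambda>n. ennreal (fock_weighted p (\<sigma> (r n)) z)) \<longlonglongrightarrow> ennreal (fock_weighted p g z)" for z
    unfolding fock_weighted_def using p
    by (intro tendsto_ennrealI tendsto_mult tendsto_const tendsto_powr' tendsto_norm lim) auto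
  have "fock_mass p g = (\<integral>\<^sup>+z. liminf (\<lambda>n. ennreal (fock_weighted p (\<sigma> (r n)) z)) \<partial>lborel)"
    unfolding fock_mass_def by (simp add: lim_imp_Liminf[OF _ lim_w])
  also have "\<dots> \<le> liminf (\<lambda>n. fock_mass p (\<sigma> (r n)))"
    unfolding fock_mass_def
    using fock_weighted_measurable[OF ball(1)[OF \<sigma>]] by (intro nn_integral_liminf) auto
  also have "\<dots> \<le> liminf (\<lambda>n. ennreal (2 * pi / p))"
    using ball(2)[OF \<sigma>] by (intro Liminf_mono always_eventually) auto
  also have "\<dots> = ennreal (2 * pi / p)" by (simp add: Liminf_const)
  finally have "g \<in> fock_unit_ball p" using g by (simp add: fock_unit_ball_iff_mass[OF p])
  then show thesis using r lim that by blast
qed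

text \<open>Subtracting the limit supplied by the normal family reduces compactness to pointwise
  null sequences. Their differences may leave the unit ball, hence the arbitrary mass bound
  \<open>B\<close>.\<close>

lemma fock_compact_weighted_compI:
  assumes p: "0 < p" and q: "0 < q" and bdd: "fock_bounded p q (weighted_comp \<psi> \<phi>)"
    and null: "\<And>g :: nat \<Rightarrow> complex \<Rightarrow> complex. \<And>B :: real.
      (\<And>n. g n holomorphic_on UNIV) \<Longrightarrow> (\<And>n. fock_mass p (g n) \<le> ennreal B) \<Longrightarrow>
      (\<And>z. (\<lambda>n. g n z) \<longlonglongrightarrow> 0) \<Longrightarrow> (\<lambda>n. fock_mass q (weighted_comp \<psi> \<phi> (g n))) \<longlonglongrightarrow> 0"
  shows "fock_compact p q (weighted_comp \<psi> \<phi>)"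
  unfolding fock_compact_iff_mass[OF q]
proof (intro conjI ballI allI impI)
  show maps: "weighted_comp \<psi> \<phi> f \<in> fock_space q" if "f \<in> fock_space p" for f
    using bdd that by (auto simp: fock_bounded_def)
  fix \<sigma> :: "nat \<Rightarrow> complex \<Rightarrow> complex" assume \<sigma>: "\<forall>n. \<sigma> n \<in> fock_unit_ball p"
  obtain g r where g: "g \<in> fock_unit_ball p" "strict_mono r" "\<And>z. (\<lambda>n. \<sigma> (r n) z) \<longlonglongrightarrow> g z"
    using fock_unit_ball_normal_family[OF p, of \<sigma>] \<sigma> by blast
  have ball: "f holomorphic_on UNIV" "fock_mass p f \<le> ennreal (2 * pi / p)" if "f \<in> fock_unit_ball p" for f
    using that by (auto simp: fock_unit_ball_iff_mass[OF p])
  have "(\<lambda>n. fock_mass q (weighted_comp \<psi> \<phi> (\<lambda>z. \<sigma> (r n) z - g z))) \<longlonglongrightarrow> 0"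
  proof (rule null)
    fix n
    have h: "\<sigma> (r n) holomorphic_on UNIV" "g holomorphic_on UNIV"
      using \<sigma> g(1) ball(1) by auto
    then show "(\<lambda>z. \<sigma> (r n) z - g z) holomorphic_on UNIV" by (intro holomorphic_on_diff)
    note fock_mass_diff_le[OF p h]
    also have "ennreal (2 powr p) * (fock_mass p (\<sigma> (r n)) + fock_mass p g) \<le>
        ennreal (2 powr p) * (ennreal (2 * pi / p) + ennreal (2 * pi / p))"
      using \<sigma> g(1) ball(2) by (intro mult_left_mono add_mono) auto
    also have "\<dots> = ennreal (2 powr p * (2 * pi / p + 2 * pi / p))"
      using p by (simp only: ennreal_mult ennreal_plus add_nonneg_nonneg divide_nonneg_pos
          mult_nonneg_nonneg powr_ge_zero pi_ge_zero zero_le_numeral)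
    finally show "fock_mass p (\<lambda>z. \<sigma> (r n) z - g z) \<le> ennreal (2 powr p * (2 * pi / p + 2 * pi / p))" .
  next
    fix z
    show "(\<lambda>n. \<sigma> (r n) z - g z) \<longlonglongrightarrow> 0" using g(3)[of z] by (simp add: LIM_zero_iff)
  qed
  moreover have "weighted_comp \<psi> \<phi> (\<lambda>z. \<sigma> (r n) z - g z) =
      (\<lambda>z. weighted_comp \<psi> \<phi> (\<sigma> (r n)) z - weighted_comp \<psi> \<phi> g z)" for n
    by (simp add: weighted_comp_def fun_eq_iff algebra_simps)
  moreover have "weighted_comp \<psi> \<phi> g \<in> fock_space q"
    using g(1) by (intro maps) (simp add: fock_unit_ball_def)
  ultimately show "\<exists>l r. l \<in> fock_space q \<and> strict_mono r \<and>
      (\<lambda>n. fock_mass q (\<lambda>z. weighted_comp \<psi> \<phi> (\<sigma> (r n)) z - l z)) \<longlonglongrightarrow> 0"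
    using g(2) by auto
qed

lemma fock_compact_of_const:
  assumes p: "0 < p" and q: "0 < q" and psi: "\<psi> \<in> fock_space q" and const: "\<And>z. \<phi> z = b"
  shows "fock_compact p q (weighted_comp \<psi> \<phi>)"
proof (rule fock_compact_weighted_compI[OF p q fock_bounded_of_const[OF p q psi const]])
  fix g :: "nat \<Rightarrow> complex \<Rightarrow> complex"
  assume lim: "\<And>z. (\<lambda>n. g n z) \<longlonglongrightarrow> 0"
  have hpsi: "\<psi> holomorphic_on UNIV" using psi by (simp add: fock_space_def)
  obtain B where B: "0 \<le> B" "fock_mass q \<psi> = ennreal B"
    using fock_mass_finite_bound[OF psi] by metis
  have "weighted_comp \<psi> \<phi> (g n) = (\<lambda>z. g n b * \<psi> z)" for n
    by (simp add: weighted_comp_def const mult.commute)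
  then have eq: "fock_mass q (weighted_comp \<psi> \<phi> (g n)) = ennreal (cmod (g n b) powr q * B)" for n
    using B by (simp add: fock_mass_cmult[OF hpsi] ennreal_mult)
  have "(\<lambda>n. cmod (g n b) powr q * B) \<longlonglongrightarrow> cmod 0 powr q * B"
    using q by (intro tendsto_mult tendsto_powr' tendsto_norm lim tendsto_const) auto
  then have "(\<lambda>n. ennreal (cmod (g n b) powr q * B)) \<longlonglongrightarrow> ennreal 0"
    by (intro tendsto_ennrealI) simp
  then show "(\<lambda>n. fock_mass q (weighted_comp \<psi> \<phi> (g n))) \<longlonglongrightarrow> 0"
    unfolding eq by simp
qed

text \<open>The integral is split at a large radius: inside, dominated convergence applies thanks to
  the uniform pointwise bound; outside, the small weight multiplies a mass that stays
  bounded.\<close>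

lemma fock_compact_of_symbol_weight:
  assumes p: "0 < p" and q: "p \<le> q" and psi: "\<psi> holomorphic_on UNIV" and phi: "\<phi> holomorphic_on UNIV"
    and affine: "\<And>z. \<phi> z = a * z + b" and a: "a \<noteq> 0" and M: "\<And>z. symbol_weight \<psi> \<phi> z \<le> M"
    and vanish: "\<And>e. 0 < e \<Longrightarrow> \<exists>R. \<forall>z. R \<le> cmod z \<longrightarrow> symbol_weight \<psi> \<phi> z \<le> e"
  shows "fock_compact p q (weighted_comp \<psi> \<phi>)"
proof -
  have q0: "0 < q" using p q by simp
  show ?thesis
  proof (rule fock_compact_weighted_compI[OF p q0 fock_bounded_of_symbol_weight[OF p q psi phi affine a M]])
    fix g :: "nat \<Rightarrow> complex \<Rightarrow> complex" and B :: real
    assume g: "\<And>n. g n holomorphic_on UNIV" and gB: "\<And>n. fock_mass p (g n) \<le> ennreal B"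
      and lim: "\<And>z. (\<lambda>n. g n z) \<longlonglongrightarrow> 0"
    obtain K :: real where K: "0 \<le> K" "\<And>f. f holomorphic_on UNIV \<Longrightarrow>
         (\<integral>\<^sup>+z. fock_weighted q f (a * z + b) \<partial>lborel) \<le> K * fock_mass q f"
      using nn_integral_fock_weighted_affine[OF q0 a] by metis
    obtain D :: real where D: "0 \<le> D"
      "\<And>f. f holomorphic_on UNIV \<Longrightarrow> fock_mass p f \<le> ennreal B \<Longrightarrow> fock_mass q f \<le> ennreal D"
      using fock_mass_mono_exponent[OF p q] by metis
    have gD: "fock_mass q (g n) \<le> ennreal D" for n by (rule D(2)[OF g gB])
    obtain c :: real where c: "0 < c"
      "\<And>f z. f holomorphic_on UNIV \<Longrightarrow> ennreal (fock_weighted q f z) \<le> c * fock_mass q f"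
      using fock_weighted_le_mass[OF q0] by metis
    have pt: "fock_weighted q (g n) z \<le> c * D" for n z
    proof -
      note c(2)[OF g[of n], of z]
      also have "c * fock_mass q (g n) \<le> ennreal c * ennreal D" using gD by (intro mult_left_mono) auto
      finally have "ennreal (fock_weighted q (g n) z) \<le> ennreal (c * D)"
        using c(1) D(1) by (simp add: ennreal_mult)
      then show ?thesis using c(1) D(1) by (subst (asm) ennreal_le_iff) auto
    qed
    have lim_w: "(\<lambda>n. fock_weighted q (g n) z) \<longlonglongrightarrow> 0" for z
    proof -
      have "(\<lambda>n. fock_weighted q (g n) z) \<longlonglongrightarrow> cmod 0 powr q * exp (- (q * (cmod z)\<^sup>2 / 2))"
        unfolding fock_weighted_def using q0
        by (intro tendsto_mult tendsto_const tendsto_powr' tendsto_norm lim) auto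
      then show ?thesis by simp
    qed
    show "(\<lambda>n. fock_mass q (weighted_comp \<psi> \<phi> (g n))) \<longlonglongrightarrow> 0"
      unfolding ennreal_tendsto_0_iff_le
    proof (intro allI impI)
      fix e :: real assume e: "0 < e"
      \<comment> \<open>Makes the outer part at most \<open>e / 2\<close>; the added 1 covers the
        case \<open>K * D = 0\<close>. The root \<open>\<epsilon> powr (1 / q)\<close> below
        compensates the power \<open>q\<close> of the weight.\<close>
      define \<epsilon> where "\<epsilon> = e / (2 * (K * D + 1))"
      have KD: "0 \<le> K * D" using K(1) D(1) by simp
      then have \<epsilon>: "0 < \<epsilon>" "\<epsilon> * (K * D) \<le> e / 2" using e by (auto simp: \<epsilon>_def field_simps)
      obtain R where R: "\<And>z. R \<le> cmod z \<Longrightarrow> symbol_weight \<psi> \<phi> z \<le> \<epsilon> powr (1 / q)"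
        using vanish[of "\<epsilon> powr (1 / q)"] \<epsilon>(1) by auto
      define I where "I n z = ennreal (M powr q * fock_weighted q (g n) (a * z + b)) * indicator (ball 0 R) z" for n z
      have meas [measurable]: "fock_weighted q (g n) \<in> borel_measurable borel" for n
        using fock_weighted_measurable[OF g] by simp
      have meas_ball [measurable]: "ball (0 :: complex) R \<in> sets borel" by simp
      have I_meas [measurable]: "I n \<in> borel_measurable lborel" for n
        unfolding I_def by measurable
      have "(\<lambda>n. \<integral>\<^sup>+z. I n z \<partial>lborel) \<longlonglongrightarrow> (\<integral>\<^sup>+z. 0 \<partial>(lborel :: complex measure))"
      proof (rule nn_integral_dominated_convergence[where w = "\<lambda>z. ennreal (M powr q * (c * D)) * indicator (ball 0 R) z"])
        show "(\<integral>\<^sup>+z. ennreal (M powr q * (c * D)) * indicator (ball 0 R) z \<partial>(lborel :: complex measure)) < \<infinity>"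
          using emeasure_lborel_ball_finite[of "0 :: complex" R]
          by (simp add: nn_integral_cmult_indicator ennreal_mult_less_top)
        show "AE z in lborel. I n z \<le> ennreal (M powr q * (c * D)) * indicator (ball 0 R) z" for n
          unfolding I_def using pt by (intro AE_I2 mult_right_mono ennreal_leI mult_left_mono) auto
        show "AE z in lborel. (\<lambda>n. I n z) \<longlonglongrightarrow> 0"
        proof (rule AE_I2)
          fix z
          have "(\<lambda>n. M powr q * fock_weighted q (g n) (a * z + b)) \<longlonglongrightarrow> M powr q * 0"
            by (intro tendsto_mult tendsto_const lim_w)
          then have "(\<lambda>n. ennreal (M powr q * fock_weighted q (g n) (a * z + b))) \<longlonglongrightarrow> ennreal 0"
            by (intro tendsto_ennrealI) simp
          then show "(\<lambda>n. I n z) \<longlonglongrightarrow> 0"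
            unfolding I_def by (cases "z \<in> ball 0 R") simp_all
        qed
      qed (measurable)
      then have "(\<lambda>n. \<integral>\<^sup>+z. I n z \<partial>lborel) \<longlonglongrightarrow> 0" by simp
      then have "\<forall>\<^sub>F n in sequentially. (\<integral>\<^sup>+z. I n z \<partial>lborel) \<le> ennreal (e / 2)"
        unfolding ennreal_tendsto_0_iff_le using e by simp
      then show "\<forall>\<^sub>F n in sequentially. fock_mass q (weighted_comp \<psi> \<phi> (g n)) \<le> ennreal e"
      proof eventually_elim
        case (elim n)
        have bound: "ennreal (fock_weighted q (weighted_comp \<psi> \<phi> (g n)) z) \<le>
            I n z + ennreal \<epsilon> * fock_weighted q (g n) (a * z + b)" for z
        proof -
          have "ennreal (symbol_weight \<psi> \<phi> z powr q * fock_weighted q (g n) (a * z + b)) \<le>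
              I n z + ennreal \<epsilon> * fock_weighted q (g n) (a * z + b)"
          proof (cases "cmod z < R")
            case True
            have "symbol_weight \<psi> \<phi> z powr q * fock_weighted q (g n) (a * z + b)
                \<le> M powr q * fock_weighted q (g n) (a * z + b)"
              using M[of z] q0 symbol_weight_nonneg fock_weighted_nonneg
              by (intro mult_right_mono powr_mono2) auto
            then have "ennreal (symbol_weight \<psi> \<phi> z powr q * fock_weighted q (g n) (a * z + b)) \<le> I n z"
              using True by (simp add: I_def ennreal_leI)
            then show ?thesis by (rule order_trans) simp
          next
            case False
            have "symbol_weight \<psi> \<phi> z powr q \<le> (\<epsilon> powr (1 / q)) powr q"
              using False R q0 symbol_weight_nonneg by (intro powr_mono2) auto
            also have "\<dots> = \<epsilon>" using \<epsilon>(1) q0 by (simp add: powr_powr)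
            finally have "symbol_weight \<psi> \<phi> z powr q * fock_weighted q (g n) (a * z + b)
                \<le> \<epsilon> * fock_weighted q (g n) (a * z + b)"
              using fock_weighted_nonneg by (intro mult_right_mono) auto
            then have "ennreal (symbol_weight \<psi> \<phi> z powr q * fock_weighted q (g n) (a * z + b))
                \<le> ennreal \<epsilon> * fock_weighted q (g n) (a * z + b)"
              using \<epsilon>(1) fock_weighted_nonneg by (simp add: ennreal_leI flip: ennreal_mult)
            then show ?thesis by (rule order_trans) simp
          qed
          then show ?thesis by (simp add: fock_weighted_weighted_comp affine)
        qed
        have "fock_mass q (weighted_comp \<psi> \<phi> (g n)) \<le>
            (\<integral>\<^sup>+z. I n z + ennreal \<epsilon> * fock_weighted q (g n) (a * z + b) \<partial>lborel)"
          unfolding fock_mass_def by (rule nn_integral_mono) (rule bound)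
        also have "\<dots> = (\<integral>\<^sup>+z. I n z \<partial>lborel) + (\<integral>\<^sup>+z. ennreal \<epsilon> * fock_weighted q (g n) (a * z + b) \<partial>lborel)"
          by (rule nn_integral_add) measurable
        also have "(\<integral>\<^sup>+z. ennreal \<epsilon> * fock_weighted q (g n) (a * z + b) \<partial>lborel)
            = ennreal \<epsilon> * (\<integral>\<^sup>+z. fock_weighted q (g n) (a * z + b) \<partial>lborel)"
          by (rule nn_integral_cmult) measurable
        also have "(\<integral>\<^sup>+z. I n z \<partial>lborel) + \<dots> \<le> ennreal (e / 2) + ennreal \<epsilon> * (ennreal K * ennreal D)"
          using elim gD[of n]
          by (intro add_mono mult_left_mono order_trans[OF K(2)[OF g]]) auto
        also have "\<dots> = ennreal (e / 2 + \<epsilon> * (K * D))"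
          using e \<epsilon>(1) K(1) D(1) by (simp add: ennreal_mult ennreal_plus)
        also have "\<dots> \<le> ennreal e" using \<epsilon>(2) by (intro ennreal_leI) simp
        finally show ?case .
      qed
    qed
  qed
qed

section \<open>Bounded and compact differences\<close>

lemma operator_diff_diff: "A - (A - B) = (B :: 'a \<Rightarrow> 'b \<Rightarrow> 'c :: ab_group_add)"
  by (simp add: fun_eq_iff)

lemma kernel_gap_powr:
  "kernel_gap \<psi>1 \<phi>1 \<psi>2 \<phi>2 w z powr q =
     fock_weighted q ((weighted_comp \<psi>1 \<phi>1 - weighted_comp \<psi>2 \<phi>2) (fock_kernel w)) z"
  by (simp add: kernel_gap_def fock_weighted_eq_powr weighted_comp_def)

lemma kernel_gap_nonneg: "0 \<le> kernel_gap \<psi>1 \<phi>1 \<psi>2 \<phi>2 w z"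
  by (simp add: kernel_gap_def)

text \<open>All kernels lie in the unit ball, so the image masses are uniformly bounded, and so are
  the weighted point evaluations.\<close>

lemma fock_bounded_imp_kernel_gap_bounded:
  assumes p: "0 < p" and q: "0 < q"
    and bdd: "fock_bounded p q (weighted_comp \<psi>1 \<phi>1 - weighted_comp \<psi>2 \<phi>2)"
  obtains E where "\<And>w z. kernel_gap \<psi>1 \<phi>1 \<psi>2 \<phi>2 w z \<le> E"
proof -
  define T where "T = weighted_comp \<psi>1 \<phi>1 - weighted_comp \<psi>2 \<phi>2"
  obtain B :: real where B: "0 \<le> B" "\<And>f. f \<in> fock_unit_ball p \<Longrightarrow> fock_mass q (T f) \<le> ennreal B"
    using bdd unfolding fock_bounded_iff_mass[OF q] T_def by blast
  have hol: "T (fock_kernel w) holomorphic_on UNIV" for w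
    using bdd fock_kernel_in_unit_ball[OF p, of w]
    by (auto simp: fock_bounded_def fock_unit_ball_def T_def fock_space_def)
  obtain C :: real where C: "0 \<le> C" "\<And>f z. f holomorphic_on UNIV \<Longrightarrow>
      fock_mass q f \<le> ennreal B \<Longrightarrow> cmod (f z) \<le> C * exp ((cmod z)\<^sup>2 / 2)"
    using fock_mass_pointwise_bound[OF q] by metis
  have "kernel_gap \<psi>1 \<phi>1 \<psi>2 \<phi>2 w z \<le> C" for w z
  proof -
    have "cmod (T (fock_kernel w) z) \<le> C * exp ((cmod z)\<^sup>2 / 2)"
      by (intro C(2) hol B(2) fock_kernel_in_unit_ball p)
    then have "cmod (T (fock_kernel w) z) * exp (- ((cmod z)\<^sup>2 / 2)) \<le> C"
      by (simp add: exp_minus field_simps)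
    then show ?thesis by (simp add: T_def kernel_gap_def weighted_comp_def)
  qed
  then show thesis by (rule that)
qed

text \<open>A test function that vanishes at \<open>b2\<close> but not at \<open>b1\<close> removes
  the second operator, and the image is a nonzero multiple of \<open>\<psi>1\<close>.\<close>

lemma fock_bounded_diff_imp_const_space:
  assumes p: "0 < p"
    and bdd: "fock_bounded p q (weighted_comp \<psi>1 \<phi>1 - weighted_comp \<psi>2 \<phi>2)"
    and const: "\<And>z. \<phi>1 z = b1" "\<And>z. \<phi>2 z = b2" and ne: "b1 \<noteq> b2"
  shows "\<psi>1 \<in> fock_space q"
proof -
  \<comment> \<open>Chosen so that \<open>cnj w * (b1 - b2) = 1\<close>: the kernel values at
    \<open>b1\<close> and \<open>b2\<close> then differ by the factor \<open>exp 1\<close>.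
    \<open>fock_kernel 0\<close> is the constant 1.\<close>
  define w where "w = cnj (1 / (b1 - b2))"
  define f where "f z = fock_kernel w z - fock_kernel w b2 * fock_kernel 0 z" for z
  have kernel_mem: "fock_kernel v \<in> fock_space p" for v
    using fock_kernel_in_unit_ball[OF p] by (simp add: fock_unit_ball_def)
  have "f \<in> fock_space p"
    unfolding f_def by (intro fock_space_diff[OF p] fock_space_cmult kernel_mem)
  then have "(weighted_comp \<psi>1 \<phi>1 - weighted_comp \<psi>2 \<phi>2) f \<in> fock_space q"
    using bdd by (auto simp: fock_bounded_def)
  moreover have "f b2 = 0" by (simp add: f_def fock_kernel_def)
  ultimately have mem: "(\<lambda>z. \<psi>1 z * f b1) \<in> fock_space q"
    by (simp add: fun_diff_def weighted_comp_def const)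
  have "fock_kernel w b1 = exp 1 * fock_kernel w b2"
  proof -
    have "cnj w * b1 = 1 + cnj w * b2" using ne by (simp add: w_def field_simps)
    then show ?thesis by (simp add: fock_kernel_def exp_add add_diff_eq[symmetric])
  qed
  moreover have "exp 1 \<noteq> (1 :: complex)"
  proof
    assume "exp 1 = (1 :: complex)"
    then have "cmod (exp 1) = 1" by simp
    then show False unfolding norm_exp_eq_Re by simp
  qed
  ultimately have "f b1 \<noteq> 0" by (simp add: f_def fock_kernel_def)
  then have "\<psi>1 = (\<lambda>z. (1 / f b1) * (\<psi>1 z * f b1))" by auto
  then show ?thesis using fock_space_cmult[OF mem, of "1 / f b1"] by metis
qed

lemma fock_bounded_diff_imp_affine:
  assumes p: "0 < p" and q: "0 < q"
    and psi: "\<psi>1 holomorphic_on UNIV" "\<psi>2 holomorphic_on UNIV"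
    and phi: "\<phi>1 holomorphic_on UNIV" "\<phi>2 holomorphic_on UNIV"
    and nz: "\<psi>1 \<noteq> (\<lambda>z. 0)" "\<psi>2 \<noteq> (\<lambda>z. 0)" "\<phi>1 \<noteq> \<phi>2"
    and bdd: "fock_bounded p q (weighted_comp \<psi>1 \<phi>1 - weighted_comp \<psi>2 \<phi>2)"
  obtains a1 b1 a2 b2 M1 M2 where
    "\<And>z. \<phi>1 z = a1 * z + b1" "\<And>z. \<phi>2 z = a2 * z + b2"
    "\<And>z. symbol_weight \<psi>1 \<phi>1 z \<le> M1" "\<And>z. symbol_weight \<psi>2 \<phi>2 z \<le> M2"
proof -
  obtain E where E: "\<And>w z. kernel_gap \<psi>1 \<phi>1 \<psi>2 \<phi>2 w z \<le> E"
    using fock_bounded_imp_kernel_gap_bounded[OF p q bdd] by blast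
  have E': "\<And>w z. kernel_gap \<psi>2 \<phi>2 \<psi>1 \<phi>1 w z \<le> E"
    using E by (simp add: kernel_gap_swap)
  note nz' = nz(2,1) nz(3)[symmetric]
  obtain a1 b1 where 1: "\<And>z. \<phi>1 z = a1 * z + b1"
    using kernel_gap_bounded_imp_affine[OF psi phi nz E] by blast
  obtain a2 b2 where 2: "\<And>z. \<phi>2 z = a2 * z + b2"
    using kernel_gap_bounded_imp_affine[OF psi(2,1) phi(2,1) nz' E'] by blast
  obtain M1 where M1: "\<And>z. symbol_weight \<psi>1 \<phi>1 z \<le> M1"
    using symbol_weight_bounded[OF psi(1) phi(1) 1 2 nz(3) E] by blast
  obtain M2 where M2: "\<And>z. symbol_weight \<psi>2 \<phi>2 z \<le> M2"
    using symbol_weight_bounded[OF psi(2) phi(2) 2 1 nz'(3) E'] by blast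
  show thesis by (rule that[OF 1 2 M1 M2])
qed

lemma fock_bounded_diff_imp_bounded_left:
  assumes p: "0 < p" and q: "p \<le> q"
    and psi: "\<psi>1 holomorphic_on UNIV" "\<psi>2 holomorphic_on UNIV"
    and phi: "\<phi>1 holomorphic_on UNIV" "\<phi>2 holomorphic_on UNIV"
    and nz: "\<psi>1 \<noteq> (\<lambda>z. 0)" "\<psi>2 \<noteq> (\<lambda>z. 0)" "\<phi>1 \<noteq> \<phi>2"
    and bdd: "fock_bounded p q (weighted_comp \<psi>1 \<phi>1 - weighted_comp \<psi>2 \<phi>2)"
  shows "fock_bounded p q (weighted_comp \<psi>1 \<phi>1)"
proof -
  have q0: "0 < q" using p q by simp
  obtain a1 b1 a2 b2 M1 M2 where
    affine: "\<And>z. \<phi>1 z = a1 * z + b1" "\<And>z. \<phi>2 z = a2 * z + b2"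
    and M: "\<And>z. symbol_weight \<psi>1 \<phi>1 z \<le> M1" "\<And>z. symbol_weight \<psi>2 \<phi>2 z \<le> M2"
    using fock_bounded_diff_imp_affine[OF p q0 psi phi nz bdd] by blast
  consider "a1 \<noteq> 0" | "a1 = 0" "a2 \<noteq> 0" | "a1 = 0" "a2 = 0" by blast
  then show ?thesis
  proof cases
    case 1
    then show ?thesis by (intro fock_bounded_of_symbol_weight[OF p q psi(1) phi(1) affine(1) _ M(1)])
  next
    case 2
    then have "fock_bounded p q (weighted_comp \<psi>2 \<phi>2)"
      by (intro fock_bounded_of_symbol_weight[OF p q psi(2) phi(2) affine(2) _ M(2)])
    \<comment> \<open>The first operator is the second minus their reversed difference.\<close>
    from fock_bounded_diff[OF q0 this fock_bounded_minus_commute[OF q0 bdd]] show ?thesis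
      by (simp only: operator_diff_diff)
  next
    case 3
    then have const: "\<And>z. \<phi>1 z = b1" "\<And>z. \<phi>2 z = b2" using affine by auto
    moreover have "b1 \<noteq> b2" using nz(3) const by (auto simp: fun_eq_iff)
    ultimately have "\<psi>1 \<in> fock_space q" using fock_bounded_diff_imp_const_space[OF p bdd] by blast
    then show ?thesis using const(1) by (rule fock_bounded_of_const[OF p q0])
  qed
qed

section \<open>Decay of kernels and compact differences\<close>

lemma fock_kernel_tendsto_0:
  assumes w: "filterlim w at_infinity F"
  shows "((\<lambda>n. fock_kernel (w n) z) \<longlongrightarrow> 0) F"
proof (rule tendsto_norm_zero_cancel)
  have "filterlim (\<lambda>n. - cmod z + cmod (w n)) at_top F"
    by (intro filterlim_tendsto_add_at_top[OF tendsto_const] filterlim_at_infinity_imp_norm_at_top w)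
  then have "filterlim (\<lambda>n. cmod (z - w n)) at_top F"
  proof (rule filterlim_at_top_mono)
    show "\<forall>\<^sub>F n in F. - cmod z + cmod (w n) \<le> cmod (z - w n)"
      using norm_triangle_ineq2[of "w _" z] by (intro always_eventually) (simp add: norm_minus_commute)
  qed
  moreover have "((\<lambda>x. exp ((cmod z)\<^sup>2 / 2 - x\<^sup>2 / 2)) \<longlongrightarrow> 0) at_top"
    by real_asymp
  ultimately show "((\<lambda>n. cmod (fock_kernel (w n) z)) \<longlongrightarrow> 0) F"
    unfolding cmod_fock_kernel by (rule filterlim_compose[rotated])
qed

text \<open>The point evaluation constant is the same at all points, so the evaluation point may
  move with \<open>n\<close>.\<close>

lemma fock_mass_tendsto_pointwise:
  assumes q: "0 < q" and hol: "\<And>n. u n holomorphic_on UNIV"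
    and lim: "((\<lambda>n. fock_mass q (u n)) \<longlongrightarrow> 0) F"
  shows "((\<lambda>n. fock_weighted q (u n) (z n)) \<longlongrightarrow> 0) F"
proof -
  obtain c :: real where c: "0 < c"
    "\<And>f z. f holomorphic_on UNIV \<Longrightarrow> ennreal (fock_weighted q f z) \<le> c * fock_mass q f"
    using fock_weighted_le_mass[OF q] by metis
  have "((\<lambda>n. ennreal c * fock_mass q (u n)) \<longlongrightarrow> ennreal c * 0) F"
    by (intro ennreal_tendsto_cmult lim) simp
  then have "((\<lambda>n. ennreal (fock_weighted q (u n) (z n))) \<longlongrightarrow> 0) F"
    by (intro ennreal_tendsto_0_mono[OF c(2)[OF hol]]) simp
  then show ?thesis
    using tendsto_enn2real[of "\<lambda>n. ennreal (fock_weighted q (u n) (z n))" 0 F]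
    by (simp add: fock_weighted_nonneg)
qed

text \<open>If the gaps stayed above some \<open>e\<close> along a subsequence, compactness would
  give a further subsequence whose images converge in the space. The limit must be 0, and then the
  gaps tend to 0 at arbitrary points \<open>z n\<close>.\<close>

lemma fock_compact_imp_kernel_gap_tendsto_0:
  assumes p: "0 < p" and q: "0 < q"
    and comp: "fock_compact p q (weighted_comp \<psi>1 \<phi>1 - weighted_comp \<psi>2 \<phi>2)"
    and w: "filterlim w at_infinity sequentially"
  shows "(\<lambda>n. kernel_gap \<psi>1 \<phi>1 \<psi>2 \<phi>2 (w n) (z n)) \<longlonglongrightarrow> 0"
proof (rule ccontr)
  assume not: "\<not> (\<lambda>n. kernel_gap \<psi>1 \<phi>1 \<psi>2 \<phi>2 (w n) (z n)) \<longlonglongrightarrow> 0"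
  define T where "T = weighted_comp \<psi>1 \<phi>1 - weighted_comp \<psi>2 \<phi>2"
  define G where "G n = kernel_gap \<psi>1 \<phi>1 \<psi>2 \<phi>2 (w n) (z n)" for n
  obtain e where e: "0 < e" "\<exists>\<^sub>F n in sequentially. e \<le> G n"
    using not kernel_gap_nonneg unfolding tendsto_iff G_def frequently_def
    by (auto simp: dist_real_def not_le)
  then have "infinite {n. e \<le> G n}" by (simp add: frequently_cofinite cofinite_eq_sequentially[symmetric])
  then obtain s :: "nat \<Rightarrow> nat" where s: "strict_mono s" "\<And>n. e \<le> G (s n)"
    using infinite_enumerate by blast
  obtain l r where l: "l \<in> fock_space q" "strict_mono r"
      "(\<lambda>n. fock_mass q (\<lambda>z. T (fock_kernel (w (s (r n)))) z - l z)) \<longlonglongrightarrow> 0"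
    using fock_compact_subsequence[OF q comp, of "\<lambda>n. fock_kernel (w (s n))"]
      fock_kernel_in_unit_ball[OF p] unfolding T_def by blast
  define t where "t n = s (r n)" for n
  have t: "strict_mono t" using s(1) l(2) by (simp add: t_def strict_mono_def)
  have mem: "T (fock_kernel v) \<in> fock_space q" for v
    using fock_compact_maps[OF q comp] fock_kernel_in_unit_ball[OF p, of v]
    by (simp add: T_def fock_unit_ball_def)
  have wt: "filterlim (\<lambda>n. w (t n)) at_infinity sequentially"
    using filterlim_compose[OF w filterlim_subseq[OF t]] .
  have pointwise: "(\<lambda>n. T (fock_kernel (w (t n))) x) \<longlonglongrightarrow> 0" for x
  proof -
    have "(\<lambda>n. \<psi>1 x * fock_kernel (w (t n)) (\<phi>1 x) - \<psi>2 x * fock_kernel (w (t n)) (\<phi>2 x)) \<longlonglongrightarrow> \<psi>1 x * 0 - \<psi>2 x * 0"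
      by (intro tendsto_diff tendsto_mult tendsto_const fock_kernel_tendsto_0 wt)
    then show ?thesis by (simp add: T_def weighted_comp_def)
  qed
  \<comment> \<open>Convergence in mass implies pointwise convergence to \<open>l\<close>, whereas
    the images of the kernels tend to 0 at each point.\<close>
  have "l x = 0" for x
  proof -
    have "(\<lambda>n. fock_weighted q (\<lambda>z. T (fock_kernel (w (t n))) z - l z) x) \<longlonglongrightarrow> 0"
      using l(3) fock_space_diff[OF q mem l(1)]
      by (intro fock_mass_tendsto_pointwise[OF q]) (auto simp: t_def fock_space_def)
    moreover have "(\<lambda>n. fock_weighted q (\<lambda>z. T (fock_kernel (w (t n))) z - l z) x) \<longlonglongrightarrow>
        cmod (0 - l x) powr q * exp (- (q * (cmod x)\<^sup>2 / 2))"
      unfolding fock_weighted_def using q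
      by (intro tendsto_mult tendsto_const tendsto_powr' tendsto_norm tendsto_diff pointwise) auto
    ultimately have "cmod (0 - l x) powr q * exp (- (q * (cmod x)\<^sup>2 / 2)) = 0"
      using LIMSEQ_unique by blast
    then show ?thesis by simp
  qed
  then have "(\<lambda>n. fock_mass q (T (fock_kernel (w (t n))))) \<longlonglongrightarrow> 0"
    using l(3) by (simp add: t_def)
  then have "(\<lambda>n. fock_weighted q (T (fock_kernel (w (t n)))) (z (t n))) \<longlonglongrightarrow> 0"
    using mem by (intro fock_mass_tendsto_pointwise[OF q]) (auto simp: fock_space_def)
  then have "(\<lambda>n. G (t n) powr q) \<longlonglongrightarrow> 0"
    by (simp add: G_def kernel_gap_powr T_def)
  moreover have "e powr q \<le> G (t n) powr q" for n
    using s(2)[of "r n"] e(1) q by (intro powr_mono2) (auto simp: t_def)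
  ultimately have "e powr q \<le> 0" by (intro LIMSEQ_le_const) auto
  then show False using e(1) by simp
qed

lemma affine_filterlim_at_infinity:
  fixes a b :: complex
  assumes "a \<noteq> 0" "filterlim z at_infinity F"
  shows "filterlim (\<lambda>n. a * z n + b) at_infinity F"
  using tendsto_add_filterlim_at_infinity'[OF tendsto_mult_filterlim_at_infinity[OF tendsto_const assms] tendsto_const] .

text \<open>The separation estimate evaluates kernels centred at both \<open>\<phi>1 z\<close> and
  \<open>\<phi>2 z\<close>; both slopes are nonzero so that both centres escape to infinity with
  \<open>z\<close>.\<close>

lemma fock_compact_imp_symbol_weight_vanish:
  assumes p: "0 < p" and q: "0 < q"
    and comp: "fock_compact p q (weighted_comp \<psi>1 \<phi>1 - weighted_comp \<psi>2 \<phi>2)"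
    and affine: "\<And>z. \<phi>1 z = a1 * z + b1" "\<And>z. \<phi>2 z = a2 * z + b2"
    and a: "a1 \<noteq> 0" "a2 \<noteq> 0" and ne: "\<phi>1 \<noteq> \<phi>2" and e: "0 < e"
  shows "\<exists>R. \<forall>z. R \<le> cmod z \<longrightarrow> symbol_weight \<psi>1 \<phi>1 z \<le> e"
proof (rule ccontr)
  assume "\<not> ?thesis"
  then have "\<forall>n::nat. \<exists>z. real n \<le> cmod z \<and> e < symbol_weight \<psi>1 \<phi>1 z" by (auto simp: not_le)
  then obtain z where z: "\<And>n. real n \<le> cmod (z n)" "\<And>n. e < symbol_weight \<psi>1 \<phi>1 (z n)" by metis
  have z_lim: "filterlim (\<lambda>n. cmod (z n)) at_top sequentially"
    by (rule filterlim_at_top_mono[OF filterlim_real_sequentially]) (simp add: z)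
  then have z_inf: "filterlim z at_infinity sequentially"
    by (rule filterlim_norm_at_top_imp_at_infinity)
  obtain R K :: real where K: "0 < K"
    "\<And>z E. R \<le> cmod z \<Longrightarrow> kernel_gap \<psi>1 \<phi>1 \<psi>2 \<phi>2 (\<phi>1 z) z \<le> E \<Longrightarrow>
       kernel_gap \<psi>1 \<phi>1 \<psi>2 \<phi>2 (\<phi>2 z) z \<le> E \<Longrightarrow> symbol_weight \<psi>1 \<phi>1 z \<le> K * E"
    by (rule symbol_weight_le_gap_outside[OF affine ne]) (rule that)
  have phi_inf: "filterlim (\<lambda>n. \<phi>1 (z n)) at_infinity sequentially"
    "filterlim (\<lambda>n. \<phi>2 (z n)) at_infinity sequentially"
    unfolding affine by (rule affine_filterlim_at_infinity[OF _ z_inf], rule a)+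
  have lim: "(\<lambda>n. kernel_gap \<psi>1 \<phi>1 \<psi>2 \<phi>2 (\<phi>1 (z n)) (z n)) \<longlonglongrightarrow> 0"
    "(\<lambda>n. kernel_gap \<psi>1 \<phi>1 \<psi>2 \<phi>2 (\<phi>2 (z n)) (z n)) \<longlonglongrightarrow> 0"
    by (rule fock_compact_imp_kernel_gap_tendsto_0[OF p q comp], rule phi_inf)+
  have eK: "0 < e / K" using e K(1) by simp
  have "\<forall>\<^sub>F n in sequentially. R \<le> cmod (z n)"
    using z_lim by (simp add: filterlim_at_top)
  moreover have "\<forall>\<^sub>F n in sequentially. kernel_gap \<psi>1 \<phi>1 \<psi>2 \<phi>2 (\<phi>1 (z n)) (z n) < e / K"
    using lim(1) eK by (rule order_tendstoD)
  moreover have "\<forall>\<^sub>F n in sequentially. kernel_gap \<psi>1 \<phi>1 \<psi>2 \<phi>2 (\<phi>2 (z n)) (z n) < e / K"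
    using lim(2) eK by (rule order_tendstoD)
  ultimately have "\<forall>\<^sub>F n in sequentially. symbol_weight \<psi>1 \<phi>1 (z n) \<le> K * (e / K)"
    by eventually_elim (intro K(2), auto)
  then obtain n where "symbol_weight \<psi>1 \<phi>1 (z n) \<le> K * (e / K)"
    using eventually_happens' sequentially_bot by blast
  then show False using z(2)[of n] K(1) by simp
qed

text \<open>Apply the operator to the constant function 1, which is
  \<open>fock_kernel 0\<close>.\<close>

lemma fock_bounded_imp_weight_in_space:
  assumes p: "0 < p" and bdd: "fock_bounded p q (weighted_comp \<psi> \<phi>)"
  shows "\<psi> \<in> fock_space q"
proof -
  have "fock_kernel 0 \<in> fock_space p"
    using fock_kernel_in_unit_ball[OF p] by (simp add: fock_unit_ball_def)
  moreover have "weighted_comp \<psi> \<phi> (fock_kernel 0) = \<psi>"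
    by (simp add: weighted_comp_def fock_kernel_def)
  ultimately show ?thesis using bdd by (force simp: fock_bounded_def)
qed

text \<open>Boundedness of both operators is established first: it places \<open>\<psi>1\<close> and
  \<open>\<psi>2\<close> in the target space, so a constant symbol gives a compact operator of rank
  at most one.\<close>

lemma fock_compact_diff_imp_compact_left:
  assumes p: "0 < p" and q: "p \<le> q"
    and psi: "\<psi>1 holomorphic_on UNIV" "\<psi>2 holomorphic_on UNIV"
    and phi: "\<phi>1 holomorphic_on UNIV" "\<phi>2 holomorphic_on UNIV"
    and nz: "\<psi>1 \<noteq> (\<lambda>z. 0)" "\<psi>2 \<noteq> (\<lambda>z. 0)" "\<phi>1 \<noteq> \<phi>2"
    and comp: "fock_compact p q (weighted_comp \<psi>1 \<phi>1 - weighted_comp \<psi>2 \<phi>2)"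
  shows "fock_compact p q (weighted_comp \<psi>1 \<phi>1)"
proof -
  have q0: "0 < q" using p q by simp
  have bdd: "fock_bounded p q (weighted_comp \<psi>1 \<phi>1 - weighted_comp \<psi>2 \<phi>2)"
    by (rule fock_compact_imp_bounded[OF q0 comp])
  have bdd1: "fock_bounded p q (weighted_comp \<psi>1 \<phi>1)"
    by (rule fock_bounded_diff_imp_bounded_left[OF p q psi phi nz bdd])
  have bdd2: "fock_bounded p q (weighted_comp \<psi>2 \<phi>2)"
    by (rule fock_bounded_diff_imp_bounded_left[OF p q psi(2,1) phi(2,1) nz(2,1) nz(3)[symmetric]
          fock_bounded_minus_commute[OF q0 bdd]])
  obtain a1 b1 a2 b2 M1 M2 where
    affine: "\<And>z. \<phi>1 z = a1 * z + b1" "\<And>z. \<phi>2 z = a2 * z + b2"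
    and M: "\<And>z. symbol_weight \<psi>1 \<phi>1 z \<le> M1" "\<And>z. symbol_weight \<psi>2 \<phi>2 z \<le> M2"
    using fock_bounded_diff_imp_affine[OF p q0 psi phi nz bdd] by blast
  consider "a1 = 0" | "a2 = 0" | "a1 \<noteq> 0" "a2 \<noteq> 0" by blast
  then show ?thesis
  proof cases
    case 1
    then show ?thesis
      using affine(1) by (intro fock_compact_of_const[OF p q0 fock_bounded_imp_weight_in_space[OF p bdd1], of _ b1]) simp
  next
    case 2
    then have "fock_compact p q (weighted_comp \<psi>2 \<phi>2)"
      using affine(2) by (intro fock_compact_of_const[OF p q0 fock_bounded_imp_weight_in_space[OF p bdd2], of _ b2]) simp
    from fock_compact_diff[OF q0 this fock_compact_minus_commute[OF q0 comp]] show ?thesis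
      by (simp only: operator_diff_diff)
  next
    case 3
    show ?thesis
      by (rule fock_compact_of_symbol_weight[OF p q psi(1) phi(1) affine(1) 3(1) M(1)
            fock_compact_imp_symbol_weight_vanish[OF p q0 comp affine 3 nz(3)]])
  qed
qed

theorem theorem1p4:
  fixes p q :: real and \<psi>1 \<psi>2 \<phi>1 \<phi>2 :: "complex \<Rightarrow> complex"
  assumes "0 < p" and "p \<le> q"
    and "\<psi>1 holomorphic_on UNIV" and "\<psi>2 holomorphic_on UNIV"
    and "\<phi>1 holomorphic_on UNIV" and "\<phi>2 holomorphic_on UNIV"
    and "\<psi>1 \<noteq> (\<lambda>z. 0)" and "\<psi>2 \<noteq> (\<lambda>z. 0)" and "\<phi>1 \<noteq> \<phi>2"
  shows "(fock_bounded p q (weighted_comp \<psi>1 \<phi>1 - weighted_comp \<psi>2 \<phi>2) \<longleftrightarrow>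
            fock_bounded p q (weighted_comp \<psi>1 \<phi>1) \<and> fock_bounded p q (weighted_comp \<psi>2 \<phi>2)) \<and>
         (fock_compact p q (weighted_comp \<psi>1 \<phi>1 - weighted_comp \<psi>2 \<phi>2) \<longleftrightarrow>
            fock_compact p q (weighted_comp \<psi>1 \<phi>1) \<and> fock_compact p q (weighted_comp \<psi>2 \<phi>2))"
proof -
  have q0: "0 < q" using assms(1,2) by simp
  note left = assms
  \<comment> \<open>The hypotheses with the indices exchanged; the \<open>minus_commute\<close>
    lemmas reverse the difference accordingly.\<close>
  note right = assms(1,2,4,3,6,5,8,7) assms(9)[symmetric]
  show ?thesis
    using fock_bounded_diff[OF q0] fock_compact_diff[OF q0]
      fock_bounded_diff_imp_bounded_left[OF left]
      fock_bounded_diff_imp_bounded_left[OF right fock_bounded_minus_commute[OF q0]]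
      fock_compact_diff_imp_compact_left[OF left]
      fock_compact_diff_imp_compact_left[OF right fock_compact_minus_commute[OF q0]]
    by blast
qed

end
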